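(* Let $\mathcal P=\langle X:\mathcal R\rangle$ be a group presentation. The crossed $F(X)$-module $\operatorname{star}_1(\mathrm{Sq}^{\rho}(\mathcal P))\xrightarrow{\ \mathbf r\ }F(X)$ derived from the reduced Squier complex $\mathrm{Sq}^{\rho}(\mathcal P)$ is isomorphic (as a crossed $F(X)$-module) to the free crossed $F(X)$-module $C\xrightarrow{\ \partial\ }F(X)$ derived from $\mathcal P$.
   Context: A group presentation $\mathcal P=\langle X:\mathcal R\rangle$ consists of a set $X$ and a set $\mathcal R\subseteq A^*\times A^*$ of pairs of words, where $A=X\cup X^{-1}$ and $A^*$ is the free monoid on $A$. $F(X)$ is the free group on $X$. The canonical map $\rho:A^*\to F(X)$ is suppressed: for $p,q\in F(X)$ and $(l,r)\in\mathcal R$, $plq$ and $prq$ denote $p(l\rho)q,\ p(r\rho)q\in F(X)$. Maps are written on the right. Reduced Squier complex $\mathrm{Sq}^{\rho}(\mathcal P)$: the 2-complex with vertex set $F(X)$; one edge $(p,l,r,q)$ for each $p,q\in F(X)$ and $(l,r)\in\mathcal R$, starting at $plq$ and ending at $prq$; and, for all $p,q,p',q'\in F(X)$ and $(l,r),(l',r')\in\mathcal R$, a 2-cell making the edge paths $(p,l,r,qp'l'q')\circ(prqp',l',r',q')$ and $(plqp',l',r',q')\circ(p,l,r,qp'r'q')$ homotopic. $\pi(\mathrm{Sq}^{\rho}(\mathcal P),F(X))$ is its fundamental groupoid: vertex set $F(X)$, morphisms the homotopy classes (relative to endpoints) of edge paths (which may traverse edges backwards), composed by concatenation $\circ$. The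 domain and range of a morphism $\alpha$ are written $\alpha\mathbf d$ and $\alpha\mathbf r$. $\operatorname{star}_1(\mathrm{Sq}^{\rho}(\mathcal P))$ is the set of morphisms with domain $1\in F(X)$. The group $F(X)$ acts on the left and right of this groupoid by the actions induced by $u\triangleright(p,l,r,q)=(up,l,r,q)$ and $(p,l,r,q)\triangleleft v=(p,l,r,qv)$ on edges. With the group operation $\alpha*\beta=(\alpha\triangleleft\beta\mathbf d)\circ(\alpha\mathbf r\triangleright\beta)$ and the $F(X)$-action $\alpha^q=q^{-1}\triangleright\alpha\triangleleft q$, the range map $\mathbf r:\operatorname{star}_1(\mathrm{Sq}^{\rho}(\mathcal P))\to F(X)$ is a crossed module. A crossed $\Gamma$-module $(T,\partial)$ is a group homomorphism $\partial:T\to\Gamma$ with an action $(t,g)\mapsto t^g$ of $\Gamma$ on $T$ such that $(t^g)\partial=g^{-1}(t\partial)g$ and $t^{u\partial}=u^{-1}tu$ for all $t,u\in T$, $g\in\Gamma$. A morphism $\phi:(T,\partial)\to(T',\partial')$ of crossed $\Gamma$-modules is a group homomorphism $\phi:T\to T'$ with $(t^g)\phi=(t\phi)^g$ and $\phi\partial'=\partial$. $(T,\partial)$ is a free crossed $\Gamma$-module with basis $\nu:\mathcal R\to T$ (or free on $\omega=\nu\partial:\mathcal R\to\Gamma$) if for every crossed $\Gamma$-module $(T',\partial')$ and function $\sigma:\mathcal R\to T'$ with $\sigma\partial'=\nu\partial$ there is a unique morphism $\phi:(T,\partial)\to(T',\partial')$ of crossed modules with $\nu\phi=\sigma$. It exists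 for every $\omega$ and is unique up to isomorphism. The free crossed module $C\xrightarrow{\partial}F(X)$ derived from $\mathcal P$ is the free crossed $F(X)$-module on the function $\hat\rho:\mathcal R\to F(X)$, $(l,r)\hat\rho=(l^{-1}r)\rho$. Concretely, $C$ is the quotient of the free group on $\mathcal R\times F(X)$ by the (normal) subgroup generated by all elements $(r,u)^{-1}(s,v)^{-1}(r,u)(s,vu^{-1}(r\hat\rho)u)$ with $r,s\in\mathcal R$ and $u,v\in F(X)$, with action $(r,u)^v=(r,uv)$ and $(r,u)\partial=u^{-1}(r\hat\rho)u$. *)

theory Defs
  imports "HOL-Algebra.Coset" "HOL.Hull"
begin

section \<open>Free groups\<close>

text \<open>The letter \<open>(x, True)\<close> stands for the generator \<open>x\<close> and \<open>(x, False)\<close> for its formal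
  inverse, so \<open>lists (letters X)\<close> is the free monoid on the disjoint union of \<open>X\<close> and its
  formal inverses.\<close>

type_synonym 'a letter = "'a \<times> bool"
type_synonym 'a word = "'a letter list"

definition letters :: "'a set \<Rightarrow> 'a letter set"
  where "letters X = X \<times> UNIV"

definition letter_inv :: "'a letter \<Rightarrow> 'a letter"
  where "letter_inv a = (fst a, \<not> snd a)"

definition word_inv :: "'a word \<Rightarrow> 'a word"
  where "word_inv w = rev (map letter_inv w)"

text \<open>The free group consists of the freely reduced words, multiplied by concatenation followed
  by free reduction. Free reduction \<open>free_reduce\<close> is also the canonical map (called \<open>\<rho>\<close> in the
  literature) from the free monoid on the letters to the free group.\<close>

fun reduce_Cons :: "'a letter \<Rightarrow> 'a word \<Rightarrow> 'a word" where
  "reduce_Cons a [] = [a]"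
| "reduce_Cons a (b # w) = (if b = letter_inv a then w else a # b # w)"

definition free_reduce :: "'a word \<Rightarrow> 'a word"
  where "free_reduce w = foldr reduce_Cons w []"

definition free_group :: "'a set \<Rightarrow> 'a word monoid"
  where "free_group X =
    \<lparr>carrier = {w \<in> lists (letters X). successively (\<lambda>a b. b \<noteq> letter_inv a) w},
     mult = (\<lambda>v w. free_reduce (v @ w)),
     one = []\<rparr>"

definition free_gen :: "'a \<Rightarrow> 'a word"
  where "free_gen x = [(x, True)]"

text \<open>The value of a word in a group \<open>G\<close> under the assignment \<open>f\<close> of the generators; on reduced
  words this is the homomorphism from the free group to \<open>G\<close> extending \<open>f\<close>.\<close>

definition free_lift :: "('g, 'm) monoid_scheme \<Rightarrow> ('a \<Rightarrow> 'g) \<Rightarrow> 'a word \<Rightarrow> 'g"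
  where "free_lift G f w =
    foldr (\<lambda>(x, b) g. (if b then f x else inv\<^bsub>G\<^esub> (f x)) \<otimes>\<^bsub>G\<^esub> g) w \<one>\<^bsub>G\<^esub>"


section \<open>Crossed modules\<close>

text \<open>A crossed \<open>G\<close>-module is a group record extended by the boundary map and the right action
  \<open>(t, g) \<mapsto> act T t g\<close> of \<open>G\<close>.\<close>

record ('t, 'g) xmod = "'t monoid" +
  bd :: "'t \<Rightarrow> 'g"
  act :: "'t \<Rightarrow> 'g \<Rightarrow> 't"

locale crossed_module = G: group G + T: group T
  for G :: "('g, 'm) monoid_scheme" (structure) and T :: "('t, 'g, 'n) xmod_scheme" (structure) +
  assumes bd_hom: "bd T \<in> hom T G"
    and act_closed: "t \<in> carrier T \<Longrightarrow> g \<in> carrier G \<Longrightarrow> act T t g \<in> carrier T"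
    and act_one: "t \<in> carrier T \<Longrightarrow> act T t \<one>\<^bsub>G\<^esub> = t"
    and act_act: "t \<in> carrier T \<Longrightarrow> g \<in> carrier G \<Longrightarrow> h \<in> carrier G \<Longrightarrow>
      act T t (g \<otimes>\<^bsub>G\<^esub> h) = act T (act T t g) h"
    and act_mult: "t \<in> carrier T \<Longrightarrow> u \<in> carrier T \<Longrightarrow> g \<in> carrier G \<Longrightarrow>
      act T (t \<otimes>\<^bsub>T\<^esub> u) g = act T t g \<otimes>\<^bsub>T\<^esub> act T u g"
    and bd_act: "t \<in> carrier T \<Longrightarrow> g \<in> carrier G \<Longrightarrow>
      bd T (act T t g) = inv\<^bsub>G\<^esub> g \<otimes>\<^bsub>G\<^esub> bd T t \<otimes>\<^bsub>G\<^esub> g"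
    and peiffer: "t \<in> carrier T \<Longrightarrow> u \<in> carrier T \<Longrightarrow>
      act T t (bd T u) = inv\<^bsub>T\<^esub> u \<otimes>\<^bsub>T\<^esub> t \<otimes>\<^bsub>T\<^esub> u"

definition xmod_morphism ::
  "('g, 'm) monoid_scheme \<Rightarrow> ('t, 'g) xmod \<Rightarrow> ('u, 'g) xmod \<Rightarrow> ('t \<Rightarrow> 'u) \<Rightarrow> bool"
  where "xmod_morphism G T T' \<phi> \<longleftrightarrow>
    \<phi> \<in> hom T T' \<and>
    (\<forall>t \<in> carrier T. \<forall>g \<in> carrier G. \<phi> (act T t g) = act T' (\<phi> t) g) \<and>
    (\<forall>t \<in> carrier T. bd T' (\<phi> t) = bd T t)"

definition xmod_isomorphic ::
  "('g, 'm) monoid_scheme \<Rightarrow> ('t, 'g) xmod \<Rightarrow> ('u, 'g) xmod \<Rightarrow> bool"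
  where "xmod_isomorphic G T T' \<longleftrightarrow>
    crossed_module G T \<and> crossed_module G T' \<and>
    (\<exists>\<phi>. xmod_morphism G T T' \<phi> \<and> bij_betw \<phi> (carrier T) (carrier T'))"

text \<open>Freeness of \<open>T\<close> with basis \<open>\<nu> : R \<rightarrow> T\<close>. The test modules \<open>T'\<close> have their elements in the
  type \<open>'u\<close>, which is an explicit parameter because HOL cannot quantify over types inside a
  formula. Morphisms are made extensional so that uniqueness means uniqueness as maps on the
  carrier of \<open>T\<close>.\<close>

definition free_xmod_with_basis ::
  "'u itself \<Rightarrow> ('g, 'm) monoid_scheme \<Rightarrow> ('t, 'g) xmod \<Rightarrow> 'r set \<Rightarrow> ('r \<Rightarrow> 't) \<Rightarrow> bool"
  where "free_xmod_with_basis (U :: 'u itself) G T R \<nu> \<longleftrightarrow>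
    crossed_module G T \<and> \<nu> \<in> R \<rightarrow> carrier T \<and>
    (\<forall>(T' :: ('u, 'g) xmod) \<sigma>.
       crossed_module G T' \<and> \<sigma> \<in> R \<rightarrow> carrier T' \<and> (\<forall>r \<in> R. bd T' (\<sigma> r) = bd T (\<nu> r)) \<longrightarrow>
       (\<exists>!\<phi>. \<phi> \<in> extensional (carrier T) \<and> xmod_morphism G T T' \<phi> \<and> (\<forall>r \<in> R. \<phi> (\<nu> r) = \<sigma> r)))"

definition free_xmod_on ::
  "'u itself \<Rightarrow> ('g, 'm) monoid_scheme \<Rightarrow> ('t, 'g) xmod \<Rightarrow> 'r set \<Rightarrow> ('r \<Rightarrow> 'g) \<Rightarrow> bool"
  where "free_xmod_on U G T R \<omega> \<longleftrightarrow>
    (\<exists>\<nu>. free_xmod_with_basis U G T R \<nu> \<and> (\<forall>r \<in> R. bd T (\<nu> r) = \<omega> r))"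


section \<open>Combinatorial 2-complexes and their fundamental groupoids\<close>

text \<open>An oriented edge is an edge with a Boolean, \<open>False\<close> meaning that it is traversed backwards.
  A 2-cell is given by the pair of parallel edge sequences that it makes homotopic.\<close>

record ('v, 'e) complex2 =
  verts :: "'v set"
  edges :: "'e set"
  esrc :: "'e \<Rightarrow> 'v"
  etgt :: "'e \<Rightarrow> 'v"
  cells :: "(('e \<times> bool) list \<times> ('e \<times> bool) list) set"

definition osrc :: "('v, 'e) complex2 \<Rightarrow> 'e \<times> bool \<Rightarrow> 'v"
  where "osrc K a = (if snd a then esrc K (fst a) else etgt K (fst a))"

definition otgt :: "('v, 'e) complex2 \<Rightarrow> 'e \<times> bool \<Rightarrow> 'v"
  where "otgt K a = (if snd a then etgt K (fst a) else esrc K (fst a))"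

text \<open>An edge path is a start vertex together with a list of oriented edges; the start vertex is
  needed to tell apart the empty paths.\<close>

type_synonym ('v, 'e) epath = "'v \<times> ('e \<times> bool) list"

fun walk :: "('v, 'e) complex2 \<Rightarrow> 'v \<Rightarrow> ('e \<times> bool) list \<Rightarrow> bool" where
  "walk K v [] \<longleftrightarrow> v \<in> verts K"
| "walk K v (a # as) \<longleftrightarrow> fst a \<in> edges K \<and> v = osrc K a \<and> walk K (otgt K a) as"

fun walk_end :: "('v, 'e) complex2 \<Rightarrow> 'v \<Rightarrow> ('e \<times> bool) list \<Rightarrow> 'v" where
  "walk_end K v [] = v"
| "walk_end K v (a # as) = walk_end K (otgt K a) as"

definition epaths :: "('v, 'e) complex2 \<Rightarrow> ('v, 'e) epath set"
  where "epaths K = {(v, as). walk K v as}"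

inductive_set homotopy :: "('v, 'e) complex2 \<Rightarrow> (('v, 'e) epath \<times> ('v, 'e) epath) set"
  for K :: "('v, 'e) complex2" where
  refl: "P \<in> epaths K \<Longrightarrow> (P, P) \<in> homotopy K"
| sym: "(P, Q) \<in> homotopy K \<Longrightarrow> (Q, P) \<in> homotopy K"
| trans: "(P, Q) \<in> homotopy K \<Longrightarrow> (Q, S) \<in> homotopy K \<Longrightarrow> (P, S) \<in> homotopy K"
| cancel: "(v, as @ [(e, b), (e, \<not> b)] @ bs) \<in> epaths K \<Longrightarrow>
    ((v, as @ [(e, b), (e, \<not> b)] @ bs), (v, as @ bs)) \<in> homotopy K"
| cell: "(c, d) \<in> cells K \<Longrightarrow> (v, as @ c @ bs) \<in> epaths K \<Longrightarrow>
    ((v, as @ c @ bs), (v, as @ d @ bs)) \<in> homotopy K"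

definition groupoid_mors :: "('v, 'e) complex2 \<Rightarrow> ('v, 'e) epath set set"
  where "groupoid_mors K = epaths K // homotopy K"

definition mor_id :: "('v, 'e) complex2 \<Rightarrow> 'v \<Rightarrow> ('v, 'e) epath set"
  where "mor_id K v = homotopy K `` {(v, [])}"

text \<open>All representatives of a morphism have the same endpoints.\<close>

definition mor_dom :: "('v, 'e) epath set \<Rightarrow> 'v"
  where "mor_dom \<alpha> = the_elem (fst ` \<alpha>)"

definition mor_ran :: "('v, 'e) complex2 \<Rightarrow> ('v, 'e) epath set \<Rightarrow> 'v"
  where "mor_ran K \<alpha> = the_elem ((\<lambda>(v, as). walk_end K v as) ` \<alpha>)"

text \<open>Meaningful only if the range of \<open>\<alpha>\<close> is the domain of \<open>\<beta>\<close>; the union is then over one and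
  the same homotopy class.\<close>

definition mor_comp ::
  "('v, 'e) complex2 \<Rightarrow> ('v, 'e) epath set \<Rightarrow> ('v, 'e) epath set \<Rightarrow> ('v, 'e) epath set"
  where "mor_comp K \<alpha> \<beta> = (\<Union>(v, as) \<in> \<alpha>. \<Union>(w, bs) \<in> \<beta>. homotopy K `` {(v, as @ bs)})"

definition star :: "('v, 'e) complex2 \<Rightarrow> 'v \<Rightarrow> ('v, 'e) epath set set"
  where "star K v = {\<alpha> \<in> groupoid_mors K. mor_dom \<alpha> = v}"


section \<open>Group presentations and the reduced Squier complex\<close>

definition group_presentation :: "'x set \<Rightarrow> ('x word \<times> 'x word) set \<Rightarrow> bool"
  where "group_presentation X R \<longleftrightarrow> R \<subseteq> lists (letters X) \<times> lists (letters X)"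

type_synonym 'x sq_edge = "'x word \<times> 'x word \<times> 'x word \<times> 'x word"

definition squier ::
  "'x set \<Rightarrow> ('x word \<times> 'x word) set \<Rightarrow> ('x word, 'x sq_edge) complex2"
  where "squier X R =
    (let F = free_group X; \<rho> = free_reduce in
     \<lparr>verts = carrier F,
      edges = {(p, l, r, q). p \<in> carrier F \<and> q \<in> carrier F \<and> (l, r) \<in> R},
      esrc = (\<lambda>(p, l, r, q). p \<otimes>\<^bsub>F\<^esub> \<rho> l \<otimes>\<^bsub>F\<^esub> q),
      etgt = (\<lambda>(p, l, r, q). p \<otimes>\<^bsub>F\<^esub> \<rho> r \<otimes>\<^bsub>F\<^esub> q),
      cells = {([((p, l, r, q \<otimes>\<^bsub>F\<^esub> p' \<otimes>\<^bsub>F\<^esub> \<rho> l' \<otimes>\<^bsub>F\<^esub> q'), True),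
                 ((p \<otimes>\<^bsub>F\<^esub> \<rho> r \<otimes>\<^bsub>F\<^esub> q \<otimes>\<^bsub>F\<^esub> p', l', r', q'), True)],
                [((p \<otimes>\<^bsub>F\<^esub> \<rho> l \<otimes>\<^bsub>F\<^esub> q \<otimes>\<^bsub>F\<^esub> p', l', r', q'), True),
                 ((p, l, r, q \<otimes>\<^bsub>F\<^esub> p' \<otimes>\<^bsub>F\<^esub> \<rho> r' \<otimes>\<^bsub>F\<^esub> q'), True)])
               | p q p' q' l r l' r'.
                 p \<in> carrier F \<and> q \<in> carrier F \<and> p' \<in> carrier F \<and> q' \<in> carrier F \<and>
                 (l, r) \<in> R \<and> (l', r') \<in> R}\<rparr>)"

definition edge_lact :: "'x set \<Rightarrow> 'x word \<Rightarrow> 'x sq_edge \<Rightarrow> 'x sq_edge"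
  where "edge_lact X u = (\<lambda>(p, l, r, q). (u \<otimes>\<^bsub>free_group X\<^esub> p, l, r, q))"

definition edge_ract :: "'x set \<Rightarrow> 'x sq_edge \<Rightarrow> 'x word \<Rightarrow> 'x sq_edge"
  where "edge_ract X e v = (\<lambda>(p, l, r, q). (p, l, r, q \<otimes>\<^bsub>free_group X\<^esub> v)) e"

text \<open>The free group acts by automorphisms of the complex, so the image of a homotopy class
  under the action on edge paths is again a homotopy class.\<close>

definition mor_lact ::
  "'x set \<Rightarrow> 'x word \<Rightarrow> ('x word, 'x sq_edge) epath set \<Rightarrow> ('x word, 'x sq_edge) epath set"
  where "mor_lact X u \<alpha> =
    (\<lambda>(w, as). (u \<otimes>\<^bsub>free_group X\<^esub> w, map (\<lambda>(e, b). (edge_lact X u e, b)) as)) ` \<alpha>"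

definition mor_ract ::
  "'x set \<Rightarrow> ('x word, 'x sq_edge) epath set \<Rightarrow> 'x word \<Rightarrow> ('x word, 'x sq_edge) epath set"
  where "mor_ract X \<alpha> v =
    (\<lambda>(w, as). (w \<otimes>\<^bsub>free_group X\<^esub> v, map (\<lambda>(e, b). (edge_ract X e v, b)) as)) ` \<alpha>"

definition star_xmod ::
  "'x set \<Rightarrow> ('x word \<times> 'x word) set \<Rightarrow> (('x word, 'x sq_edge) epath set, 'x word) xmod"
  where "star_xmod X R =
    (let F = free_group X; K = squier X R in
     \<lparr>carrier = star K \<one>\<^bsub>F\<^esub>,
      mult = (\<lambda>\<alpha> \<beta>. mor_comp K (mor_ract X \<alpha> (mor_dom \<beta>)) (mor_lact X (mor_ran K \<alpha>) \<beta>)),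
      one = mor_id K \<one>\<^bsub>F\<^esub>,
      bd = mor_ran K,
      act = (\<lambda>\<alpha> q. mor_ract X (mor_lact X (inv\<^bsub>F\<^esub> q) \<alpha>) q)\<rparr>)"


section \<open>The free crossed module derived from a presentation\<close>

definition rho_hat :: "'x word \<times> 'x word \<Rightarrow> 'x word"
  where "rho_hat = (\<lambda>(l, r). free_reduce (word_inv l @ r))"

type_synonym 'x xgen = "('x word \<times> 'x word) \<times> 'x word"

definition xgen_group :: "'x set \<Rightarrow> ('x word \<times> 'x word) set \<Rightarrow> 'x xgen word monoid"
  where "xgen_group X R = free_group (R \<times> carrier (free_group X))"

definition peiffer_elements :: "'x set \<Rightarrow> ('x word \<times> 'x word) set \<Rightarrow> 'x xgen word set"
  where "peiffer_elements X R =
    (let F = free_group X; H = xgen_group X R in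
     {inv\<^bsub>H\<^esub> (free_gen (r, u)) \<otimes>\<^bsub>H\<^esub> inv\<^bsub>H\<^esub> (free_gen (s, v)) \<otimes>\<^bsub>H\<^esub> free_gen (r, u) \<otimes>\<^bsub>H\<^esub>
        free_gen (s, v \<otimes>\<^bsub>F\<^esub> inv\<^bsub>F\<^esub> u \<otimes>\<^bsub>F\<^esub> rho_hat r \<otimes>\<^bsub>F\<^esub> u)
      | r s u v. r \<in> R \<and> s \<in> R \<and> u \<in> carrier F \<and> v \<in> carrier F})"

definition peiffer_subgroup :: "'x set \<Rightarrow> ('x word \<times> 'x word) set \<Rightarrow> 'x xgen word set"
  where "peiffer_subgroup X R = (\<lambda>N. N \<lhd> xgen_group X R) hull peiffer_elements X R"

text \<open>The boundary and the action are defined on the free group by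
  \<open>(r, u) \<mapsto> u\<inverse> (rho_hat r) u\<close> and \<open>(r, u)\<^sup>v = (r, u v)\<close> and descend to cosets. The boundary is
  constant on each coset; the action permutes the generators, so it permutes the cosets as sets.\<close>

definition derived_xmod ::
  "'x set \<Rightarrow> ('x word \<times> 'x word) set \<Rightarrow> ('x xgen word set, 'x word) xmod"
  where "derived_xmod X R =
    (let F = free_group X; H = xgen_group X R; C = H Mod peiffer_subgroup X R in
     \<lparr>carrier = carrier C,
      mult = mult C,
      one = one C,
      bd = (\<lambda>c. the_elem (free_lift F (\<lambda>(r, u). inv\<^bsub>F\<^esub> u \<otimes>\<^bsub>F\<^esub> rho_hat r \<otimes>\<^bsub>F\<^esub> u) ` c)),
      act = (\<lambda>c v. map (\<lambda>((r, u), b). ((r, u \<otimes>\<^bsub>F\<^esub> v), b)) ` c)\<rparr>)"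

end

theory Submission
  imports Defs
begin

text \<open>An edge \<open>(p, l, r, q)\<close> is determined by its label \<open>((l, r), q)\<close> and one of its end points, so
  the edge paths starting at \<open>1\<close> are the same as words over \<open>R \<times> F(X)\<close> and formal inverses.
  Under this bijection the 2-cells turn into the Peiffer relations: with \<open>s = (l, r)\<close>,
  \<open>t = (l', r')\<close>, \<open>u = q'\<close> and \<open>v = q p' l' q'\<close>, the two sides of a 2-cell are labelled
  \<open>(s, v) (t, u)\<close> and \<open>(t, u) (s, v u\<inverse> (l'\<inverse> r') u)\<close>. Hence both crossed modules are the
  set of words modulo free cancellation and the Peiffer relations, with the same operations, and
  freeness holds because a map on words that respects the boundary respects these relations
  in every crossed module.\<close>

section \<open>Free reduction\<close>

text \<open>The 2-cells and the Peiffer relations involve only positively oriented letters, whereas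
  the crossed module law concerns arbitrary elements. This gap is closed once, on words. The
  exponent \<open>v (inv u) (rho_hat r) u\<close> is \<open>v\<close> times the boundary of the
  letter \<open>(r, u)\<close>, so a Peiffer relation says that one letter may pass another at the
  cost of being translated by the boundary of the latter. In this form the rule survives inversion
  and concatenation, and all crossed module axioms hold for words before either concrete model is
  considered. Matching 2-cells with Peiffer relations relies on inverses in F(X): for arbitrary
  \<open>u\<close> and \<open>v\<close> the equation \<open>v = q p' l' q'\<close> is solved by
  \<open>q' = u\<close>, \<open>p' = 1\<close> and \<open>q = v (inv u) (inv l')\<close>. Hence
  every pair of positive letters, read from any start vertex, is one side of a 2-cell.\<close>

abbreviation reduced :: "'a word \<Rightarrow> bool"
  where "reduced \<equiv> successively (\<lambda>a b. b \<noteq> letter_inv a)"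

lemma letter_inv_letter_inv [simp]: "letter_inv (letter_inv a) = a"
  by (simp add: letter_inv_def)

lemma letter_inv_in_letters [simp]: "letter_inv a \<in> letters Y \<longleftrightarrow> a \<in> letters Y"
  by (auto simp: letter_inv_def letters_def mem_Times_iff)

lemma letter_inv_neq [simp]: "letter_inv a \<noteq> a" "a \<noteq> letter_inv a"
  by (auto simp: letter_inv_def prod_eq_iff)

lemma word_inv_simps [simp]:
  "word_inv [] = []" "word_inv (a # w) = word_inv w @ [letter_inv a]"
  by (simp_all add: word_inv_def)

lemma word_inv_in_lists: "w \<in> lists (letters Y) \<Longrightarrow> word_inv w \<in> lists (letters Y)"
  by (induction w) auto

lemma free_reduce_simps [simp]:
  "free_reduce [] = []" "free_reduce (a # w) = reduce_Cons a (free_reduce w)"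
  by (simp_all add: free_reduce_def)

lemma reduced_reduce_Cons: "reduced w \<Longrightarrow> reduced (reduce_Cons a w)"
  by (cases w) (auto simp: successively_Cons)

lemma reduced_free_reduce: "reduced (free_reduce w)"
  by (induction w) (simp_all add: reduced_reduce_Cons)

text \<open>Van der Waerden's argument: each letter acts on the reduced words as a permutation whose
  inverse is the action of the inverse letter. Reducedness matters when \<open>w\<close> starts with
  \<open>a\<close>: the letter after it is then not \<open>letter_inv a\<close>, so restoring
  \<open>a\<close> triggers no further cancellation.\<close>

lemma reduce_Cons_cancel:
  "reduced w \<Longrightarrow> reduce_Cons a (reduce_Cons (letter_inv a) w) = w"
  by (cases w; cases "tl w") (auto simp: successively_Cons)

lemma free_reduce_reduced: "reduced w \<Longrightarrow> free_reduce w = w"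
proof (induction w)
  case (Cons a w)
  then show ?case by (cases w) (auto simp: successively_Cons)
qed simp

lemma free_reduce_in_lists: "w \<in> lists (letters Y) \<Longrightarrow> free_reduce w \<in> lists (letters Y)"
proof (induction w)
  case (Cons a w)
  have "reduce_Cons a v \<in> lists (letters Y)" if "v \<in> lists (letters Y)" for v
    using that Cons.prems by (cases v) auto
  then show ?case using Cons by simp
qed simp

lemma free_reduce_append: "free_reduce (v @ w) = foldr reduce_Cons v (free_reduce w)"
  by (simp add: free_reduce_def)

lemma free_reduce_append_right: "free_reduce (v @ free_reduce w) = free_reduce (v @ w)"
  by (simp add: free_reduce_append free_reduce_reduced reduced_free_reduce)

text \<open>Together with \<open>free_reduce_append_right\<close> this gives associativity in the
  free group: both bracketings reduce the plain concatenation.\<close>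

lemma free_reduce_append_left: "free_reduce (free_reduce v @ w) = free_reduce (v @ w)"
proof (induction v)
  case (Cons a v)
  \<comment> \<open>The only case with content is \<open>u\<close> starting with
    \<open>letter_inv a\<close>; there the right side applies \<open>letter_inv a\<close> and then
    \<open>a\<close> to a reduced word.\<close>
  have "free_reduce (reduce_Cons a u @ w) = reduce_Cons a (free_reduce (u @ w))" for u
    using reduce_Cons_cancel[of "free_reduce (tl u @ w)" a]
    by (cases u) (auto simp: reduced_free_reduce)
  then show ?case using Cons by simp
qed simp

lemma free_reduce_word_inv_append: "free_reduce (word_inv w @ w @ z) = free_reduce z"
proof (induction w arbitrary: z)
  case (Cons a w)
  have "reduce_Cons (letter_inv a) (reduce_Cons a (free_reduce (w @ z))) = free_reduce (w @ z)"
    using reduce_Cons_cancel[of "free_reduce (w @ z)" "letter_inv a"]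
    by (simp add: reduced_free_reduce)
  then have "free_reduce (word_inv w @ letter_inv a # a # w @ z) = free_reduce (word_inv w @ w @ z)"
    by (simp add: free_reduce_append)
  then show ?case using Cons by simp
qed simp

lemma free_group_simps:
  "carrier (free_group Y) = {w \<in> lists (letters Y). reduced w}"
  "v \<otimes>\<^bsub>free_group Y\<^esub> w = free_reduce (v @ w)"
  "\<one>\<^bsub>free_group Y\<^esub> = []"
  by (simp_all add: free_group_def)

lemma free_reduce_closed: "w \<in> lists (letters Y) \<Longrightarrow> free_reduce w \<in> carrier (free_group Y)"
  by (simp add: free_group_simps reduced_free_reduce free_reduce_in_lists)

lemma group_free_group: "group (free_group Y)"
proof (rule groupI)
  fix w assume w: "w \<in> carrier (free_group Y)"
  show "\<exists>v\<in>carrier (free_group Y). v \<otimes>\<^bsub>free_group Y\<^esub> w = \<one>\<^bsub>free_group Y\<^esub>"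
  proof
    show "free_reduce (word_inv w) \<in> carrier (free_group Y)"
      by (rule free_reduce_closed[OF word_inv_in_lists]) (use w in \<open>simp add: free_group_simps\<close>)
    show "free_reduce (word_inv w) \<otimes>\<^bsub>free_group Y\<^esub> w = \<one>\<^bsub>free_group Y\<^esub>"
      using free_reduce_word_inv_append[of w "[]"]
      by (simp add: free_group_simps free_reduce_append_left)
  qed
next
  fix v w assume "v \<in> carrier (free_group Y)" "w \<in> carrier (free_group Y)"
  then have "v @ w \<in> lists (letters Y)" by (simp add: free_group_simps)
  then show "v \<otimes>\<^bsub>free_group Y\<^esub> w \<in> carrier (free_group Y)"
    by (metis free_reduce_closed free_group_simps(2))
qed (simp_all add: free_group_simps free_reduce_append_left free_reduce_append_right
      free_reduce_reduced)

lemma free_reduce_append_mult: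
  "free_reduce (v @ w) = free_reduce v \<otimes>\<^bsub>free_group Y\<^esub> free_reduce w"
  by (simp add: free_group_simps free_reduce_append_left free_reduce_append_right)

lemma free_reduce_word_inv:
  assumes "w \<in> lists (letters Y)"
  shows "free_reduce (word_inv w) = inv\<^bsub>free_group Y\<^esub> (free_reduce w)"
proof -
  interpret F: group "free_group Y" by (rule group_free_group)
  have "free_reduce (word_inv w) \<otimes>\<^bsub>free_group Y\<^esub> free_reduce w = \<one>\<^bsub>free_group Y\<^esub>"
    using free_reduce_word_inv_append[of w "[]"]
    by (simp flip: free_reduce_append_mult) (simp add: free_group_simps)
  then show ?thesis
    using assms by (simp add: F.inv_equality free_reduce_closed word_inv_in_lists)
qed

section \<open>Values of words in a group\<close>

lemma free_lift_simps [simp]: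
  "free_lift G f [] = \<one>\<^bsub>G\<^esub>"
  "free_lift G f ((x, b) # w) = (if b then f x else inv\<^bsub>G\<^esub> (f x)) \<otimes>\<^bsub>G\<^esub> free_lift G f w"
  by (simp_all add: free_lift_def)

context group
begin

lemma free_lift_closed:
  "f \<in> Y \<rightarrow> carrier G \<Longrightarrow> w \<in> lists (letters Y) \<Longrightarrow> free_lift G f w \<in> carrier G"
  by (induction w) (auto simp: letters_def Pi_def)

lemma free_lift_append:
  assumes "f \<in> Y \<rightarrow> carrier G" "v \<in> lists (letters Y)" "w \<in> lists (letters Y)"
  shows "free_lift G f (v @ w) = free_lift G f v \<otimes> free_lift G f w"
  using assms(2)
proof (induction v)
  case Nil
  then show ?case using free_lift_closed[OF assms(1,3)] by simp
next
  case (Cons a v)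
  obtain x b where a: "a = (x, b)" by fastforce
  have "f x \<in> carrier G" using Cons.hyps assms(1) a by (auto simp: letters_def)
  then show ?case
    using Cons.IH free_lift_closed[OF assms(1,3)] free_lift_closed[OF assms(1) Cons.hyps(2)]
    by (simp add: a m_assoc)
qed

lemma free_lift_cancel:
  assumes "f \<in> Y \<rightarrow> carrier G" "a \<in> letters Y"
  shows "free_lift G f [a, letter_inv a] = \<one>"
proof -
  obtain x b where a: "a = (x, b)" by fastforce
  have "f x \<in> carrier G" using assms a by (auto simp: letters_def)
  then show ?thesis by (simp add: a letter_inv_def)
qed

lemma inv_mult_cancel:
  assumes "x \<in> carrier G" "y \<in> carrier G"
  shows "x \<otimes> (inv x \<otimes> y) = y" "inv x \<otimes> (x \<otimes> y) = y"
  using assms by (simp_all flip: m_assoc)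

end


text \<open>An intersection of normal subgroups is normal, provided the family is nonempty; the
  whole group is a member of it. An empty intersection would be the whole type.\<close>

lemma (in group) normal_hull:
  assumes "S \<subseteq> carrier G"
  shows "((\<lambda>N. N \<lhd> G) hull S) \<lhd> G"
proof -
  let ?A = "{N. N \<lhd> G \<and> S \<subseteq> N}"
  have "carrier G \<lhd> G" by (simp add: normal_inv_iff subgroup_self)
  with assms have "?A \<noteq> {}" by blast
  then have "subgroup (\<Inter>?A) G"
    by (intro subgroups_Inter) (auto simp: normal_inv_iff)
  then show ?thesis
    unfolding hull_def by (subst normal_inv_iff) (auto simp: normal_inv_iff)
qed

section \<open>Words modulo free cancellation and the Peiffer relations\<close>

declare in_listsD [rule del] in_listsI [rule del]

locale presentation =
  fixes X :: "'x set" and R :: "('x word \<times> 'x word) set"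
  assumes presentation: "group_presentation X R"
begin

abbreviation F :: "'x word monoid" where "F \<equiv> free_group X"

abbreviation gens :: "'x xgen set" where "gens \<equiv> R \<times> carrier F"

abbreviation xwords :: "'x xgen word set" where "xwords \<equiv> lists (letters gens)"

sublocale F: group "free_group X" by (rule group_free_group)

lemmas F_simps = F.m_assoc F.inv_mult_group F.inv_mult_cancel

lemma xletter_iff [simp]: "((r, u), b) \<in> letters gens \<longleftrightarrow> r \<in> R \<and> u \<in> carrier F"
  by (simp add: letters_def)

lemma rho_closed [simp]:
  assumes "(l, r) \<in> R"
  shows "free_reduce l \<in> carrier F" "free_reduce r \<in> carrier F"
  using assms presentation by (auto simp: group_presentation_def intro!: free_reduce_closed)

lemma rho_hat_eq:
  assumes "(l, r) \<in> R"
  shows "rho_hat (l, r) = inv\<^bsub>F\<^esub> free_reduce l \<otimes>\<^bsub>F\<^esub> free_reduce r"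
proof -
  have "l \<in> lists (letters X)"
    using assms presentation by (auto simp: group_presentation_def)
  then show ?thesis
    by (simp add: rho_hat_def free_reduce_word_inv free_reduce_append_mult[where Y = X])
qed

lemma rho_hat_closed [simp]: "r \<in> R \<Longrightarrow> rho_hat r \<in> carrier F"
  by (cases r) (simp add: rho_hat_eq)

section \<open>Boundary and action on words\<close>

definition xbd :: "'x xgen word \<Rightarrow> 'x word"
  where "xbd = free_lift F (\<lambda>(r, u). inv\<^bsub>F\<^esub> u \<otimes>\<^bsub>F\<^esub> rho_hat r \<otimes>\<^bsub>F\<^esub> u)"

text \<open>On labels of edge paths this is the effect of right translation; left translation leaves
  the labels unchanged.\<close>

definition shift :: "'x word \<Rightarrow> 'x xgen word \<Rightarrow> 'x xgen word"
  where "shift v = map (\<lambda>((r, u), b). ((r, u \<otimes>\<^bsub>F\<^esub> v), b))"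

lemma xbd_Nil [simp]: "xbd [] = \<one>\<^bsub>F\<^esub>"
  by (simp add: xbd_def)

lemma xbd_gen_closed:
  "(\<lambda>(r, u). inv\<^bsub>F\<^esub> u \<otimes>\<^bsub>F\<^esub> rho_hat r \<otimes>\<^bsub>F\<^esub> u) \<in> gens \<rightarrow> carrier F"
  by auto

lemma xbd_closed [simp]: "w \<in> xwords \<Longrightarrow> xbd w \<in> carrier F"
  unfolding xbd_def by (rule F.free_lift_closed[OF xbd_gen_closed])

lemma xbd_append: "v \<in> xwords \<Longrightarrow> w \<in> xwords \<Longrightarrow> xbd (v @ w) = xbd v \<otimes>\<^bsub>F\<^esub> xbd w"
  unfolding xbd_def by (rule F.free_lift_append[OF xbd_gen_closed])

lemma xbd_Cons:
  "a \<in> letters gens \<Longrightarrow> w \<in> xwords \<Longrightarrow> xbd (a # w) = xbd [a] \<otimes>\<^bsub>F\<^esub> xbd w"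
  using xbd_append[of "[a]" w] by simp

lemma xbd_letter:
  assumes "r \<in> R" "u \<in> carrier F"
  shows "xbd [((r, u), True)] = inv\<^bsub>F\<^esub> u \<otimes>\<^bsub>F\<^esub> rho_hat r \<otimes>\<^bsub>F\<^esub> u"
    and "xbd [((r, u), False)] = inv\<^bsub>F\<^esub> u \<otimes>\<^bsub>F\<^esub> inv\<^bsub>F\<^esub> rho_hat r \<otimes>\<^bsub>F\<^esub> u"
  using assms by (simp_all add: xbd_def F_simps)

lemma xbd_letter_inv:
  assumes "a \<in> letters gens"
  shows "xbd [letter_inv a] = inv\<^bsub>F\<^esub> xbd [a]"
proof -
  obtain r u b where "a = ((r, u), b)" by (metis prod.exhaust)
  then show ?thesis
    using assms by (cases b) (simp_all add: letter_inv_def xbd_letter F_simps)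
qed

lemma shift_simps [simp]:
  "shift v [] = []"
  "shift v (((r, u), b) # w) = ((r, u \<otimes>\<^bsub>F\<^esub> v), b) # shift v w"
  "shift v (w @ w') = shift v w @ shift v w'"
  by (simp_all add: shift_def)

lemma shift_closed [simp]: "v \<in> carrier F \<Longrightarrow> w \<in> xwords \<Longrightarrow> shift v w \<in> xwords"
  by (induction w) (auto simp: letters_def)

lemma shift_one [simp]: "w \<in> xwords \<Longrightarrow> shift \<one>\<^bsub>F\<^esub> w = w"
  by (induction w) (auto simp: letters_def)

lemma shift_shift [simp]:
  "v \<in> carrier F \<Longrightarrow> v' \<in> carrier F \<Longrightarrow> w \<in> xwords \<Longrightarrow>
    shift v' (shift v w) = shift (v \<otimes>\<^bsub>F\<^esub> v') w"
  by (induction w) (auto simp: letters_def F.m_assoc)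

lemma xbd_shift:
  assumes "v \<in> carrier F" "w \<in> xwords"
  shows "xbd (shift v w) = inv\<^bsub>F\<^esub> v \<otimes>\<^bsub>F\<^esub> xbd w \<otimes>\<^bsub>F\<^esub> v"
  using assms(2)
proof (induction w)
  case Nil
  then show ?case using assms by simp
next
  case (Cons a w)
  obtain r u b where a: "a = ((r, u), b)" by (metis prod.exhaust)
  have "xbd [((r, u \<otimes>\<^bsub>F\<^esub> v), b)] = inv\<^bsub>F\<^esub> v \<otimes>\<^bsub>F\<^esub> xbd [a] \<otimes>\<^bsub>F\<^esub> v"
    using Cons.hyps assms by (cases b) (simp_all add: a xbd_letter F_simps)
  then show ?case
    using Cons assms
      xbd_Cons[of a w] xbd_Cons[of "((r, u \<otimes>\<^bsub>F\<^esub> v), b)" "shift v w"] xbd_closed[of "[a]"]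
    by (simp add: a F_simps)
qed

text \<open>The common description of both models. The contexts \<open>xs\<close> and
  \<open>ys\<close> are built into the generating steps so that the rules run parallel to those of
  \<open>homotopy\<close>.\<close>

inductive pcong :: "'x xgen word \<Rightarrow> 'x xgen word \<Rightarrow> bool" where
  refl: "w \<in> xwords \<Longrightarrow> pcong w w"
| sym: "pcong v w \<Longrightarrow> pcong w v"
| trans: "pcong u v \<Longrightarrow> pcong v w \<Longrightarrow> pcong u w"
| cancel: "xs \<in> xwords \<Longrightarrow> ys \<in> xwords \<Longrightarrow> a \<in> letters gens \<Longrightarrow>
    pcong (xs @ [a, letter_inv a] @ ys) (xs @ ys)"
| peiffer: "xs \<in> xwords \<Longrightarrow> ys \<in> xwords \<Longrightarrow> r \<in> R \<Longrightarrow> s \<in> R \<Longrightarrow> u \<in> carrier F \<Longrightarrow> v \<in> carrier F \<Longrightarrow>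
    pcong (xs @ [((s, v), True), ((r, u), True)] @ ys)
      (xs @ [((r, u), True), ((s, v \<otimes>\<^bsub>F\<^esub> inv\<^bsub>F\<^esub> u \<otimes>\<^bsub>F\<^esub> rho_hat r \<otimes>\<^bsub>F\<^esub> u), True)] @ ys)"

declare pcong.trans [trans]

lemma pcong_xwords: "pcong v w \<Longrightarrow> v \<in> xwords \<and> w \<in> xwords"
  by (induction rule: pcong.induct) auto

lemma pcong_context:
  assumes "pcong v w" "xs \<in> xwords" "ys \<in> xwords"
  shows "pcong (xs @ v @ ys) (xs @ w @ ys)"
  using assms(1)
proof (induction rule: pcong.induct)
  case (cancel xs' ys' a)
  then show ?case using assms pcong.cancel[of "xs @ xs'" "ys' @ ys" a] by simp
next
  case (peiffer xs' ys' r s u v)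
  then show ?case using assms pcong.peiffer[of "xs @ xs'" "ys' @ ys" r s u v] by simp
next
  case (refl w)
  then show ?case using assms by (simp add: pcong.refl)
qed (blast intro: pcong.sym pcong.trans)+

lemma pcong_append:
  assumes "pcong v v'" "pcong w w'"
  shows "pcong (v @ w) (v' @ w')"
proof (rule pcong.trans)
  show "pcong (v @ w) (v' @ w)"
    using pcong_context[OF assms(1), of "[]" w] pcong_xwords[OF assms(2)] by simp
  show "pcong (v' @ w) (v' @ w')"
    using pcong_context[OF assms(2), of v' "[]"] pcong_xwords[OF assms(1)] by simp
qed

text \<open>Each class of words contains a reduced one, so the quotient of all words is also a
  quotient of the free group on the same generators.\<close>

lemma pcong_free_reduce: "w \<in> xwords \<Longrightarrow> pcong w (free_reduce w)"
proof (induction w)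
  case Nil
  then show ?case by (simp add: pcong.refl)
next
  case (Cons a w)
  have w: "free_reduce w \<in> xwords" using Cons.prems by (simp add: free_reduce_in_lists)
  have "pcong (a # v) (reduce_Cons a v)" if v: "v \<in> xwords" for v
  proof (cases "\<exists>z. v = letter_inv a # z")
    case True
    then obtain z where z: "v = letter_inv a # z" by blast
    then show ?thesis using pcong.cancel[of "[]" z a] Cons.prems v by simp
  next
    case False
    then have "reduce_Cons a v = a # v" by (cases v) auto
    then show ?thesis using Cons.prems v pcong.refl[of "a # v"] by simp
  qed
  then have "pcong (a # free_reduce w) (reduce_Cons a (free_reduce w))" using w .
  moreover have "pcong (a # w) (a # free_reduce w)"
    using pcong_context[of w "free_reduce w" "[a]" "[]"] Cons by simp
  ultimately show ?case by (simp, blast intro: pcong.trans)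
qed

lemma pcong_word_inv:
  assumes "w \<in> xwords"
  shows "pcong (word_inv w @ w) []"
  using pcong_free_reduce[of "word_inv w @ w"] free_reduce_word_inv_append[of w "[]"] assms
    word_inv_in_lists[OF assms] by simp

text \<open>In a Peiffer relation the letter \<open>(s, v)\<close> is translated by the boundary of
  \<open>(r, u)\<close>, so its own boundary is conjugated by that of \<open>(r, u)\<close>, and the
  two products agree.\<close>

lemma pcong_xbd: "pcong v w \<Longrightarrow> xbd v = xbd w"
proof (induction rule: pcong.induct)
  case (cancel xs ys a)
  have "xbd [a, letter_inv a] = \<one>\<^bsub>F\<^esub>"
    unfolding xbd_def by (rule F.free_lift_cancel[OF xbd_gen_closed cancel(3)])
  with cancel show ?case
    using xbd_append[of xs "[a, letter_inv a] @ ys"] xbd_append[of "[a, letter_inv a]" ys]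
    by (simp add: xbd_append)
next
  case (peiffer xs ys r s u v)
  let ?A = "[((s, v), True), ((r, u), True)]"
  let ?B = "[((r, u), True), ((s, v \<otimes>\<^bsub>F\<^esub> inv\<^bsub>F\<^esub> u \<otimes>\<^bsub>F\<^esub> rho_hat r \<otimes>\<^bsub>F\<^esub> u), True)]"
  have "xbd ?A = xbd ?B"
    using peiffer by (simp add: xbd_def F_simps)
  with peiffer show ?case
    using xbd_append[of xs "?A @ ys"] xbd_append[of xs "?B @ ys"] xbd_append[of ?A ys]
      xbd_append[of ?B ys] by simp
qed simp_all

lemma pcong_shift:
  assumes "pcong w w'" "g \<in> carrier F"
  shows "pcong (shift g w) (shift g w')"
  using assms(1)
proof (induction rule: pcong.induct)
  case (cancel xs ys a)
  obtain r u b where a: "a = ((r, u), b)" by (metis prod.exhaust)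
  show ?case
    using cancel assms pcong.cancel[of "shift g xs" "shift g ys" "((r, u \<otimes>\<^bsub>F\<^esub> g), b)"]
    by (simp add: a letter_inv_def)
next
  case (peiffer xs ys r s u v)
  then show ?case
    using assms pcong.peiffer[of "shift g xs" "shift g ys" r s "u \<otimes>\<^bsub>F\<^esub> g" "v \<otimes>\<^bsub>F\<^esub> g"]
    by (simp add: F_simps)
next
  case (refl w)
  then show ?case using assms by (simp add: pcong.refl)
qed (blast intro: pcong.sym pcong.trans)+

section \<open>The Peiffer identity for arbitrary words\<close>

lemma pcong_letter_swap:
  assumes "r \<in> R" "u \<in> carrier F" "a \<in> letters gens"
  shows "pcong [a, ((r, u), True)] (((r, u), True) # shift (xbd [((r, u), True)]) [a])"
proof -
  obtain s v b where a: "a = ((s, v), b)" by (metis prod.exhaust)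
  define v' where "v' = v \<otimes>\<^bsub>F\<^esub> inv\<^bsub>F\<^esub> u \<otimes>\<^bsub>F\<^esub> rho_hat r \<otimes>\<^bsub>F\<^esub> u"
  have sv: "s \<in> R" "v \<in> carrier F" "v' \<in> carrier F"
    using assms by (auto simp: a v'_def)
  have *: "shift (xbd [((r, u), True)]) [a] = [((s, v'), b)]"
    using assms sv by (simp add: a v'_def xbd_letter F_simps)
  have swap: "pcong [((s, v), True), ((r, u), True)] [((r, u), True), ((s, v'), True)]"
    using pcong.peiffer[of "[]" "[]" r s u v] assms sv by (simp add: v'_def)
  show ?thesis
  proof (cases b)
    case True
    then show ?thesis using swap * by (simp add: a)
  next
    case False
    \<comment> \<open>For an inverse letter, \<open>swap\<close> is multiplied by the inverse of
      \<open>(s, v)\<close> on the left and the inverse of \<open>(s, v')\<close> on the right; one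
      cancellation on each side leaves the claim.\<close>
    have "pcong [((s, v), False), ((r, u), True), ((s, v'), True), ((s, v'), False)]
        [((s, v), False), ((r, u), True)]"
      using pcong.cancel[of "[((s, v), False), ((r, u), True)]" "[]" "((s, v'), True)"] assms sv
      by (simp add: letter_inv_def)
    moreover have "pcong [((s, v), False), ((s, v), True), ((r, u), True), ((s, v'), False)]
        [((s, v), False), ((r, u), True), ((s, v'), True), ((s, v'), False)]"
      using pcong_context[OF swap, of "[((s, v), False)]" "[((s, v'), False)]"] assms sv by simp
    moreover have "pcong [((s, v), False), ((s, v), True), ((r, u), True), ((s, v'), False)]
        [((r, u), True), ((s, v'), False)]"
      using pcong.cancel[of "[]" "[((r, u), True), ((s, v'), False)]" "((s, v), False)"] assms sv
      by (simp add: letter_inv_def)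
    ultimately show ?thesis
      using False * by (simp add: a) (meson pcong.sym pcong.trans)
  qed
qed

lemma pcong_swap_positive:
  assumes "r \<in> R" "u \<in> carrier F" "w \<in> xwords"
  shows "pcong (w @ [((r, u), True)]) (((r, u), True) # shift (xbd [((r, u), True)]) w)"
  using assms(3)
proof (induction w)
  case Nil
  then show ?case using assms by (simp add: pcong.refl)
next
  case (Cons a w)
  let ?g = "xbd [((r, u), True)]"
  have g: "?g \<in> carrier F" using assms by simp
  obtain s v b where a: "a = ((s, v), b)" by (metis prod.exhaust)
  have "pcong (a # w @ [((r, u), True)]) (a # ((r, u), True) # shift ?g w)"
    using pcong_context[OF Cons.IH, of "[a]" "[]"] Cons.hyps by simp
  moreover have "pcong (a # ((r, u), True) # shift ?g w)
      (((r, u), True) # shift ?g [a] @ shift ?g w)"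
    using pcong_context[OF pcong_letter_swap[OF assms(1,2) Cons.hyps(1)], of "[]" "shift ?g w"]
      Cons.hyps g by simp
  ultimately show ?case by (simp add: a, blast intro: pcong.trans)
qed

lemma pcong_swap_letter:
  assumes "a \<in> letters gens" "w \<in> xwords"
  shows "pcong (w @ [a]) (a # shift (xbd [a]) w)"
proof -
  obtain r u b where a: "a = ((r, u), b)" by (metis prod.exhaust)
  show ?thesis
  proof (cases b)
    case True
    then show ?thesis using assms pcong_swap_positive by (simp add: a)
  next
    case False
    let ?c = "((r, u), True)" and ?w = "shift (xbd [a]) w"
    have ru: "r \<in> R" "u \<in> carrier F" using assms by (auto simp: a)
    have inv: "letter_inv a = ?c" "letter_inv ?c = a" by (simp_all add: a False letter_inv_def)
    \<comment> \<open>\<open>?c\<close> is the inverse of \<open>a\<close>, so moving it past the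
      translated word \<open>?w\<close> turns that word back into \<open>w\<close>. Multiplying by
      \<open>a\<close> on both sides then gives the rule for \<open>a\<close>.\<close>
    have "xbd [?c] = inv\<^bsub>F\<^esub> xbd [a]" using xbd_letter_inv[OF assms(1)] inv by simp
    then have "shift (xbd [?c]) ?w = w" using assms by simp
    then have "pcong (?w @ [?c]) (?c # w)"
      using pcong_swap_positive[OF ru, of ?w] assms by simp
    then have "pcong (a # ?w @ [?c, a]) (a # ?c # w @ [a])"
      using pcong_context[of "?w @ [?c]" "?c # w" "[a]" "[a]"] assms by simp
    moreover have "pcong (a # ?w @ [?c, a]) (a # ?w)"
      using pcong.cancel[of "a # ?w" "[]" ?c] assms ru inv by simp
    moreover have "pcong (a # ?c # w @ [a]) (w @ [a])"
      using pcong.cancel[of "[]" "w @ [a]" a] assms inv by simp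
    ultimately show ?thesis by (meson pcong.sym pcong.trans)
  qed
qed

text \<open>The law \<open>u\<inverse> t u = act t (bd u)\<close> in inverse-free form. The
  preceding lemmas admit first either sign and then any length on the left of the swap, then either
  sign on the right; the induction here handles the length on the right, using that successive
  shifts multiply to the shift by the boundary of the whole word.\<close>

lemma pcong_swap:
  assumes "w \<in> xwords" "v \<in> xwords"
  shows "pcong (w @ v) (v @ shift (xbd v) w)"
  using assms(2,1)
proof (induction v arbitrary: w)
  case Nil
  then show ?case by (simp add: pcong.refl)
next
  case (Cons a v)
  let ?g = "xbd [a]"
  have g: "?g \<in> carrier F" using Cons by simp
  have "pcong ((w @ [a]) @ v) (a # shift ?g w @ v)"
    using pcong_context[OF pcong_swap_letter[OF Cons.hyps(1) Cons.prems], of "[]" v] Cons.hyps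
    by simp
  moreover have "pcong (a # shift ?g w @ v) (a # v @ shift (xbd v) (shift ?g w))"
    using pcong_context[OF Cons.IH[of "shift ?g w"], of "[a]" "[]"] Cons g by simp
  moreover have "shift (xbd v) (shift ?g w) = shift (xbd (a # v)) w"
    using Cons g xbd_Cons[of a v] by simp
  ultimately show ?case by (simp, blast intro: pcong.trans)
qed

end

text \<open>The interface through which both models are treated: \<open>\<kappa>\<close> identifies
  \<open>T\<close> with the words modulo \<open>pcong\<close>. \<open>T\<close> is a bare record
  here; that it is a crossed module, that it is free, and that any two instances are isomorphic are
  all consequences.\<close>

locale word_xmod = presentation X R
  for X :: "'x set" and R :: "('x word \<times> 'x word) set" +
  fixes T :: "('t, 'x word) xmod" and \<kappa> :: "'x xgen word \<Rightarrow> 't"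
  assumes carrier_eq: "carrier T = \<kappa> ` xwords"
    and eq_iff: "v \<in> xwords \<Longrightarrow> w \<in> xwords \<Longrightarrow> \<kappa> v = \<kappa> w \<longleftrightarrow> pcong v w"
    and mult_eq: "v \<in> xwords \<Longrightarrow> w \<in> xwords \<Longrightarrow> \<kappa> v \<otimes>\<^bsub>T\<^esub> \<kappa> w = \<kappa> (v @ w)"
    and one_eq: "\<one>\<^bsub>T\<^esub> = \<kappa> []"
    and bd_eq: "w \<in> xwords \<Longrightarrow> bd T (\<kappa> w) = xbd w"
    and act_eq: "w \<in> xwords \<Longrightarrow> g \<in> carrier F \<Longrightarrow> act T (\<kappa> w) g = \<kappa> (shift g w)"
begin

lemma kappa_closed [simp]: "w \<in> xwords \<Longrightarrow> \<kappa> w \<in> carrier T"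
  by (simp add: carrier_eq)

lemma inv_into_kappa:
  assumes "w \<in> xwords"
  shows "inv_into xwords \<kappa> (\<kappa> w) \<in> xwords" and "pcong (inv_into xwords \<kappa> (\<kappa> w)) w"
proof -
  have "\<kappa> w \<in> \<kappa> ` xwords" using assms by blast
  then have *: "inv_into xwords \<kappa> (\<kappa> w) \<in> xwords" "\<kappa> (inv_into xwords \<kappa> (\<kappa> w)) = \<kappa> w"
    by (rule inv_into_into, rule f_inv_into_f)
  then show "inv_into xwords \<kappa> (\<kappa> w) \<in> xwords" "pcong (inv_into xwords \<kappa> (\<kappa> w)) w"
    using eq_iff[OF *(1) assms] by simp_all
qed

lemma group_T: "group T"
proof (rule groupI)
  fix t assume "t \<in> carrier T"
  then obtain w where w: "w \<in> xwords" "t = \<kappa> w" by (auto simp: carrier_eq)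
  show "\<exists>t'\<in>carrier T. t' \<otimes>\<^bsub>T\<^esub> t = \<one>\<^bsub>T\<^esub>"
  proof
    show "\<kappa> (word_inv w) \<otimes>\<^bsub>T\<^esub> t = \<one>\<^bsub>T\<^esub>"
      using w word_inv_in_lists[OF w(1)] pcong_word_inv[OF w(1)]
      by (simp add: mult_eq one_eq eq_iff)
  qed (use w word_inv_in_lists[OF w(1)] in simp)
qed (auto simp: carrier_eq one_eq mult_eq)

sublocale T: group T by (rule group_T)

lemma crossed_module: "crossed_module F T"
proof (unfold_locales)
  show "bd T \<in> hom T F"
    by (rule homI) (auto simp: carrier_eq mult_eq bd_eq xbd_append)
next
  fix t u assume "t \<in> carrier T" "u \<in> carrier T"
  then obtain v w where vw: "v \<in> xwords" "w \<in> xwords" "t = \<kappa> v" "u = \<kappa> w"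
    by (auto simp: carrier_eq)
  \<comment> \<open>The law is checked after left multiplication by \<open>u\<close>, since the
    interface describes products of classes but not inverses.\<close>
  then have "u \<otimes>\<^bsub>T\<^esub> act T t (bd T u) = t \<otimes>\<^bsub>T\<^esub> u"
    using pcong_swap[of v w] by (simp add: bd_eq act_eq mult_eq eq_iff pcong.sym)
  then show "act T t (bd T u) = inv\<^bsub>T\<^esub> u \<otimes>\<^bsub>T\<^esub> t \<otimes>\<^bsub>T\<^esub> u"
    using vw T.inv_mult_cancel(2)[of u "act T t (bd T u)"]
    by (simp add: bd_eq act_eq T.m_assoc)
qed (auto simp: carrier_eq mult_eq bd_eq act_eq xbd_shift)

section \<open>Freeness\<close>

lemma generated_by_basis:
  assumes "(r, u) \<in> gens"
  shows "\<kappa> [((r, u), True)] = act T (\<kappa> [((r, \<one>\<^bsub>F\<^esub>), True)]) u"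
    and "\<kappa> [((r, u), False)] = inv\<^bsub>T\<^esub> \<kappa> [((r, u), True)]"
proof -
  show "\<kappa> [((r, u), True)] = act T (\<kappa> [((r, \<one>\<^bsub>F\<^esub>), True)]) u"
    using assms by (simp add: act_eq)
  have "\<kappa> [((r, u), False)] \<otimes>\<^bsub>T\<^esub> \<kappa> [((r, u), True)] = \<one>\<^bsub>T\<^esub>"
    using assms pcong_word_inv[of "[((r, u), True)]"]
    by (simp add: mult_eq one_eq eq_iff letter_inv_def)
  then show "\<kappa> [((r, u), False)] = inv\<^bsub>T\<^esub> \<kappa> [((r, u), True)]"
    using assms by (simp add: T.inv_equality)
qed

text \<open>Every letter is a translate of a basis letter \<open>(r, 1)\<close> or the inverse of
  such a translate, so equivariance and multiplicativity determine a morphism.\<close>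

lemma morphism_unique:
  assumes T': "crossed_module F T'"
    and \<phi>: "xmod_morphism F T T' \<phi>" and \<psi>: "xmod_morphism F T T' \<psi>"
    and basis: "\<And>r. r \<in> R \<Longrightarrow> \<phi> (\<kappa> [((r, \<one>\<^bsub>F\<^esub>), True)]) = \<psi> (\<kappa> [((r, \<one>\<^bsub>F\<^esub>), True)])"
    and w: "w \<in> xwords"
  shows "\<phi> (\<kappa> w) = \<psi> (\<kappa> w)"
  using w
proof (induction w)
  interpret T': crossed_module F T' by (rule T')
  interpret \<phi>: group_hom T T' \<phi>
    using \<phi> by unfold_locales (simp add: xmod_morphism_def)
  interpret \<psi>: group_hom T T' \<psi>
    using \<psi> by unfold_locales (simp add: xmod_morphism_def)
  {
    case Nil
    show ?case by (simp flip: one_eq)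
  next
    case (Cons a w)
    obtain r u b where a: "a = ((r, u), b)" by (metis prod.exhaust)
    have ru: "(r, u) \<in> gens" using Cons.hyps by (simp add: a)
    have "\<phi> (\<kappa> [((r, u), True)]) = \<psi> (\<kappa> [((r, u), True)])"
      unfolding generated_by_basis(1)[OF ru]
      using ru basis[of r] \<phi> \<psi> by (simp add: xmod_morphism_def)
    then have "\<phi> (\<kappa> [a]) = \<psi> (\<kappa> [a])"
      using ru by (cases b) (simp_all add: a generated_by_basis(2)[OF ru])
    moreover have "\<kappa> (a # w) = \<kappa> [a] \<otimes>\<^bsub>T\<^esub> \<kappa> w" using Cons.hyps by (simp add: mult_eq)
    ultimately show ?case using Cons by simp
  }
qed

lemma morphism_exists:
  fixes T' :: "('u, 'x word) xmod"
  assumes T': "crossed_module F T'" and \<sigma>: "\<sigma> \<in> R \<rightarrow> carrier T'"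
    and bd_\<sigma>: "\<And>r. r \<in> R \<Longrightarrow> bd T' (\<sigma> r) = rho_hat r"
  obtains \<phi> where "\<phi> \<in> extensional (carrier T)" "xmod_morphism F T T' \<phi>"
    "\<And>r. r \<in> R \<Longrightarrow> \<phi> (\<kappa> [((r, \<one>\<^bsub>F\<^esub>), True)]) = \<sigma> r"
proof -
  interpret T': crossed_module F T' by (rule T')
  interpret bd: group_hom T' F "bd T'" by unfold_locales (rule T'.bd_hom)
  \<comment> \<open>This value is forced: \<open>(r, u)\<close> is the translate by \<open>u\<close>
    of the basis letter \<open>(r, 1)\<close>, which has to go to \<open>\<sigma> r\<close>.\<close>
  let ?f = "\<lambda>(r, u). act T' (\<sigma> r) u"
  define \<tau> where "\<tau> = free_lift T' ?f"
  have f: "?f \<in> gens \<rightarrow> carrier T'" using \<sigma> by (auto intro: T'.act_closed)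
  have \<sigma>_closed: "\<sigma> r \<in> carrier T'" if "r \<in> R" for r using \<sigma> that by blast
  have \<tau>_Nil: "\<tau> [] = \<one>\<^bsub>T'\<^esub>" by (simp add: \<tau>_def)
  have \<tau>_closed: "\<tau> w \<in> carrier T'" if "w \<in> xwords" for w
    unfolding \<tau>_def by (rule T'.T.free_lift_closed[OF f that])
  have \<tau>_append: "\<tau> (v @ w) = \<tau> v \<otimes>\<^bsub>T'\<^esub> \<tau> w" if "v \<in> xwords" "w \<in> xwords" for v w
    unfolding \<tau>_def by (rule T'.T.free_lift_append[OF f that])
  have \<tau>_pos: "\<tau> [((r, u), True)] = act T' (\<sigma> r) u" if "r \<in> R" "u \<in> carrier F" for r u
    using funcset_mem[OF f, of "(r, u)"] that by (simp add: \<tau>_def)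
  have \<tau>_neg: "\<tau> [((r, u), False)] = inv\<^bsub>T'\<^esub> \<tau> [((r, u), True)]" if "r \<in> R" "u \<in> carrier F" for r u
    using funcset_mem[OF f, of "(r, u)"] that by (simp add: \<tau>_def)
  have \<tau>_bd_pos: "bd T' (\<tau> [((r, u), True)]) = xbd [((r, u), True)]"
    if "r \<in> R" "u \<in> carrier F" for r u
    using that by (simp add: \<tau>_pos xbd_letter T'.bd_act bd_\<sigma> \<sigma>_closed)
  have act_inv: "act T' (inv\<^bsub>T'\<^esub> t) g = inv\<^bsub>T'\<^esub> act T' t g" if "t \<in> carrier T'" "g \<in> carrier F" for t g
  proof -
    interpret act: group_hom T' T' "\<lambda>t. act T' t g"
      by unfold_locales (use that in \<open>auto intro!: homI T'.act_closed T'.act_mult\<close>)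
    show ?thesis using that by simp
  qed
  have act_one: "act T' \<one>\<^bsub>T'\<^esub> g = \<one>\<^bsub>T'\<^esub>" if "g \<in> carrier F" for g
  proof -
    interpret act: group_hom T' T' "\<lambda>t. act T' t g"
      by unfold_locales (use that in \<open>auto intro!: homI T'.act_closed T'.act_mult\<close>)
    show ?thesis by simp
  qed
  have \<tau>_bd: "bd T' (\<tau> w) = xbd w" if "w \<in> xwords" for w
    using that
  proof (induction w)
    case (Cons a w)
    obtain r u b where a: "a = ((r, u), b)" by (metis prod.exhaust)
    have ru: "r \<in> R" "u \<in> carrier F" using Cons.hyps by (auto simp: a)
    have "bd T' (\<tau> [a]) = xbd [a]"
      using ru \<tau>_closed[of "[((r, u), True)]"] xbd_letter_inv[of "((r, u), True)"]
      by (cases b) (simp_all add: a \<tau>_neg \<tau>_bd_pos letter_inv_def)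
    then show ?case
      using Cons \<tau>_append[of "[a]" w] \<tau>_closed[of "[a]"] \<tau>_closed[of w] xbd_Cons[of a w] by simp
  qed (simp add: \<tau>_Nil)
  have \<tau>_act: "act T' (\<tau> w) g = \<tau> (shift g w)" if "w \<in> xwords" and g: "g \<in> carrier F" for w g
    using that(1)
  proof (induction w)
    case (Cons a w)
    obtain r u b where a: "a = ((r, u), b)" by (metis prod.exhaust)
    have ru: "r \<in> R" "u \<in> carrier F" using Cons.hyps by (auto simp: a)
    have pos: "act T' (\<tau> [((r, u), True)]) g = \<tau> [((r, u \<otimes>\<^bsub>F\<^esub> g), True)]"
      using ru g T'.act_act[of "\<sigma> r" u g] by (simp add: \<tau>_pos \<sigma>_closed)
    have "act T' (\<tau> [a]) g = \<tau> (shift g [a])"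
      using ru g pos act_inv[OF \<tau>_closed[of "[((r, u), True)]"] g]
      by (cases b) (simp_all add: a \<tau>_neg)
    then show ?case
      using Cons g \<tau>_append[of "[a]" w] \<tau>_append[of "shift g [a]" "shift g w"] \<tau>_closed[of "[a]"]
        \<tau>_closed[of w] T'.act_mult[of "\<tau> [a]" "\<tau> w" g] shift_simps(3)[of g "[a]" w]
        shift_closed[of g "[a]"] by simp
  qed (simp add: \<tau>_Nil act_one g)
  have \<tau>_pcong: "\<tau> v = \<tau> w" if "pcong v w" for v w
    using that
  proof (induction rule: pcong.induct)
    case (cancel xs ys a)
    have "\<tau> [a, letter_inv a] = \<one>\<^bsub>T'\<^esub>"
      unfolding \<tau>_def by (rule T'.T.free_lift_cancel[OF f cancel(3)])
    with cancel show ?case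
      using \<tau>_append[of xs "[a, letter_inv a] @ ys"] \<tau>_append[of "[a, letter_inv a]" ys] \<tau>_closed[of ys]
      by (simp add: \<tau>_append)
  next
    case (peiffer xs ys r s u v)
    let ?v' = "v \<otimes>\<^bsub>F\<^esub> inv\<^bsub>F\<^esub> u \<otimes>\<^bsub>F\<^esub> rho_hat r \<otimes>\<^bsub>F\<^esub> u"
    let ?a = "\<tau> [((s, v), True)]" and ?b = "\<tau> [((r, u), True)]"
    let ?A = "[((s, v), True), ((r, u), True)]" and ?B = "[((r, u), True), ((s, ?v'), True)]"
    have ab: "?a \<in> carrier T'" "?b \<in> carrier T'" using peiffer by (simp_all add: \<tau>_closed)
    \<comment> \<open>\<open>?v'\<close> is \<open>v\<close> times the boundary of
      \<open>(r, u)\<close>, and \<open>\<tau>\<close> preserves boundaries. The translate of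
      \<open>?a\<close> is therefore one by the boundary of \<open>?b\<close>, to which the Peiffer
      law of \<open>T'\<close> applies.\<close>
    have "\<tau> [((s, ?v'), True)] = act T' ?a (bd T' ?b)"
      using peiffer by (simp add: \<tau>_act \<tau>_bd_pos xbd_letter F.m_assoc)
    also have "\<dots> = inv\<^bsub>T'\<^esub> ?b \<otimes>\<^bsub>T'\<^esub> ?a \<otimes>\<^bsub>T'\<^esub> ?b" using ab by (rule T'.peiffer)
    finally have "\<tau> ?A = \<tau> ?B"
      using peiffer ab \<tau>_append[of "[((s, v), True)]" "[((r, u), True)]"]
        \<tau>_append[of "[((r, u), True)]" "[((s, ?v'), True)]"]
      by (simp add: T'.T.m_assoc T'.T.inv_mult_cancel)
    with peiffer show ?case
      using \<tau>_append[of xs "?A @ ys"] \<tau>_append[of xs "?B @ ys"] \<tau>_append[of ?A ys]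
        \<tau>_append[of ?B ys] by simp
  qed simp_all
  \<comment> \<open>The representative chosen by \<open>inv_into\<close> does not matter because
    \<open>\<tau>\<close> is constant on classes. The restriction to the carrier supplies the
    extensionality under which uniqueness is formulated.\<close>
  define \<phi> where "\<phi> = restrict (\<lambda>t. \<tau> (inv_into xwords \<kappa> t)) (carrier T)"
  have \<phi>: "\<phi> (\<kappa> w) = \<tau> w" if "w \<in> xwords" for w
    using that \<tau>_pcong[OF inv_into_kappa(2)[OF that]] by (simp add: \<phi>_def)
  show thesis
  proof (rule that)
    show "\<phi> \<in> extensional (carrier T)" by (simp add: \<phi>_def)
    show "xmod_morphism F T T' \<phi>"
      unfolding xmod_morphism_def
      by (auto intro!: homI simp: carrier_eq mult_eq act_eq bd_eq \<phi> \<tau>_append \<tau>_act \<tau>_bd \<tau>_closed)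
    show "\<phi> (\<kappa> [((r, \<one>\<^bsub>F\<^esub>), True)]) = \<sigma> r" if "r \<in> R" for r
      using that by (simp add: \<phi> \<tau>_pos T'.act_one \<sigma>_closed)
  qed
qed

lemma free_xmod_on: "free_xmod_on TYPE('u) F T R rho_hat"
  unfolding free_xmod_on_def free_xmod_with_basis_def
proof (intro exI conjI ballI allI impI)
  let ?\<nu> = "\<lambda>r. \<kappa> [((r, \<one>\<^bsub>F\<^esub>), True)]"
  show bd_\<nu>: "bd T (?\<nu> r) = rho_hat r" if "r \<in> R" for r
    using that by (simp add: bd_eq xbd_letter)
  show "?\<nu> \<in> R \<rightarrow> carrier T" by simp
  fix T' :: "('u, 'x word) xmod" and \<sigma>
  assume A: "crossed_module F T' \<and> \<sigma> \<in> R \<rightarrow> carrier T' \<and> (\<forall>r\<in>R. bd T' (\<sigma> r) = bd T (?\<nu> r))"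
  then obtain \<phi> where \<phi>: "\<phi> \<in> extensional (carrier T)" "xmod_morphism F T T' \<phi>"
    "\<And>r. r \<in> R \<Longrightarrow> \<phi> (?\<nu> r) = \<sigma> r"
    using morphism_exists[of T' \<sigma>] bd_\<nu> by metis
  show "\<exists>!\<phi>. \<phi> \<in> extensional (carrier T) \<and> xmod_morphism F T T' \<phi> \<and> (\<forall>r\<in>R. \<phi> (?\<nu> r) = \<sigma> r)"
  proof (rule ex1I)
    fix \<psi>
    assume \<psi>: "\<psi> \<in> extensional (carrier T) \<and> xmod_morphism F T T' \<psi> \<and> (\<forall>r\<in>R. \<psi> (?\<nu> r) = \<sigma> r)"
    show "\<psi> = \<phi>"
    proof (rule extensionalityI)
      fix t assume "t \<in> carrier T"
      then show "\<psi> t = \<phi> t"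
        using morphism_unique[of T' \<psi> \<phi>] A \<phi> \<psi> by (auto simp: carrier_eq)
    qed (use \<phi> \<psi> in auto)
  qed (use \<phi> in auto)
qed (rule crossed_module)

end

text \<open>\<open>\<kappa>\<close> and \<open>\<kappa>'\<close> identify the same pairs of words,
  so sending \<open>\<kappa> w\<close> to \<open>\<kappa>' w\<close> is both well defined and
  injective; the operations agree because each is computed on words.\<close>

lemma word_xmod_isomorphic:
  assumes "word_xmod X R T \<kappa>" and "word_xmod X R T' \<kappa>'"
  shows "xmod_isomorphic (free_group X) T T'"
proof -
  interpret T: word_xmod X R T \<kappa> by (rule assms)
  interpret T': word_xmod X R T' \<kappa>' by (rule assms)
  define \<phi> where "\<phi> t = \<kappa>' (inv_into T.xwords \<kappa> t)" for t
  have \<phi>: "\<phi> (\<kappa> w) = \<kappa>' w" if "w \<in> T.xwords" for w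
    using T'.eq_iff[of "inv_into T.xwords \<kappa> (\<kappa> w)" w] T.inv_into_kappa[OF that] that
    by (simp add: \<phi>_def)
  have "xmod_morphism (free_group X) T T' \<phi>"
    unfolding xmod_morphism_def
    by (auto intro!: homI simp: T.carrier_eq T'.carrier_eq T.mult_eq T'.mult_eq T.act_eq T'.act_eq
        T.bd_eq T'.bd_eq \<phi>)
  moreover have "bij_betw \<phi> (carrier T) (carrier T')"
    by (rule bij_betw_imageI)
      (auto simp: inj_on_def T.carrier_eq T'.carrier_eq \<phi> T.eq_iff T'.eq_iff image_image)
  ultimately show ?thesis
    unfolding xmod_isomorphic_def using T.crossed_module T'.crossed_module by blast
qed

section \<open>The derived crossed module\<close>

context presentation
begin

abbreviation H :: "'x xgen word monoid" where "H \<equiv> xgen_group X R"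

abbreviation N :: "'x xgen word set" where "N \<equiv> peiffer_subgroup X R"

lemma H_eq: "H = free_group gens"
  by (simp add: xgen_group_def)

sublocale H: group "xgen_group X R"
  unfolding H_eq by (rule group_free_group)

lemma H_iff: "x \<in> carrier H \<longleftrightarrow> x \<in> xwords \<and> reduced x"
  unfolding H_eq by (simp only: free_group_simps(1) mem_Collect_eq)

lemma H_one: "\<one>\<^bsub>H\<^esub> = []"
  by (simp add: H_eq free_group_simps(3))

lemma H_xwords: "x \<in> carrier H \<Longrightarrow> x \<in> xwords"
  by (simp add: H_iff)

lemma pcong_mult: "v \<in> xwords \<Longrightarrow> w \<in> xwords \<Longrightarrow> pcong (v \<otimes>\<^bsub>H\<^esub> w) (v @ w)"
  using pcong_free_reduce[of "v @ w"] by (simp add: H_eq free_group_simps pcong.sym)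

lemma pcong_inv:
  assumes "w \<in> carrier H"
  shows "pcong (inv\<^bsub>H\<^esub> w) (word_inv w)"
proof -
  have "inv\<^bsub>H\<^esub> w = free_reduce (word_inv w)"
    using free_reduce_word_inv[OF H_xwords[OF assms]] assms
    by (simp add: H_iff free_reduce_reduced flip: H_eq)
  then show ?thesis
    using assms pcong_free_reduce[of "word_inv w"] by (simp add: H_xwords word_inv_in_lists pcong.sym)
qed

lemma gen_closed: "r \<in> R \<Longrightarrow> u \<in> carrier F \<Longrightarrow> free_gen (r, u) \<in> carrier H"
  by (simp add: H_iff free_gen_def)

lemma peiffer_elements_subset: "peiffer_elements X R \<subseteq> carrier H"
  by (auto simp: peiffer_elements_def Let_def gen_closed)

lemma normal_N: "N \<lhd> H"
  unfolding peiffer_subgroup_def by (rule H.normal_hull[OF peiffer_elements_subset])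

sublocale N: normal N H by (rule normal_N)

lemma peiffer_elements_N: "peiffer_elements X R \<subseteq> N"
  unfolding peiffer_subgroup_def by (rule hull_subset)

text \<open>With \<open>x\<close>, \<open>y\<close>, \<open>y'\<close> for the three generators, the
  relation turns \<open>x y'\<close> into \<open>y x\<close>, after which the word
  \<open>x\<inverse> y\<inverse> y x\<close> cancels from the middle.\<close>

lemma pcong_peiffer_element:
  assumes "r \<in> R" "s \<in> R" "u \<in> carrier F" "v \<in> carrier F"
  shows "pcong (inv\<^bsub>H\<^esub> free_gen (r, u) \<otimes>\<^bsub>H\<^esub> inv\<^bsub>H\<^esub> free_gen (s, v) \<otimes>\<^bsub>H\<^esub> free_gen (r, u) \<otimes>\<^bsub>H\<^esub>
    free_gen (s, v \<otimes>\<^bsub>F\<^esub> inv\<^bsub>F\<^esub> u \<otimes>\<^bsub>F\<^esub> rho_hat r \<otimes>\<^bsub>F\<^esub> u)) []"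
proof -
  define v' where "v' = v \<otimes>\<^bsub>F\<^esub> inv\<^bsub>F\<^esub> u \<otimes>\<^bsub>F\<^esub> rho_hat r \<otimes>\<^bsub>F\<^esub> u"
  define x y y' where "x = free_gen (r, u)" and "y = free_gen (s, v)" and "y' = free_gen (s, v')"
  have c: "x \<in> carrier H" "y \<in> carrier H" "y' \<in> carrier H"
    using assms by (simp_all add: x_def y_def y'_def v'_def gen_closed)
  have mult: "pcong (a \<otimes>\<^bsub>H\<^esub> b) (a' @ b')"
    if "a \<in> carrier H" "b \<in> carrier H" "pcong a a'" "pcong b b'" for a b a' b'
    using that pcong_mult[of a b] by (auto intro: pcong_append pcong.trans H_xwords)
  have refl: "pcong a a" if "a \<in> carrier H" for a
    using that by (simp add: H_xwords pcong.refl)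
  have w: "word_inv x \<in> xwords" "word_inv y \<in> xwords" "x \<in> xwords" "y \<in> xwords"
    using c by (simp_all add: H_xwords word_inv_in_lists)
  have xy: "pcong (x @ y') (y @ x)"
    using pcong.peiffer[of "[]" "[]" r s u v] assms
    by (simp add: x_def y_def y'_def v'_def free_gen_def pcong.sym)
  have "pcong (inv\<^bsub>H\<^esub> x \<otimes>\<^bsub>H\<^esub> inv\<^bsub>H\<^esub> y \<otimes>\<^bsub>H\<^esub> x \<otimes>\<^bsub>H\<^esub> y') (((word_inv x @ word_inv y) @ x) @ y')"
    using c by (intro mult pcong_inv refl) auto
  also have "((word_inv x @ word_inv y) @ x) @ y' = (word_inv x @ word_inv y) @ (x @ y') @ []"
    by simp
  also have "pcong \<dots> ((word_inv x @ word_inv y) @ (y @ x) @ [])"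
    using w by (intro pcong_context xy) auto
  also have "(word_inv x @ word_inv y) @ (y @ x) @ [] = word_inv x @ (word_inv y @ y) @ x"
    by simp
  also have "pcong \<dots> (word_inv x @ [] @ x)"
    using w by (intro pcong_context pcong_word_inv) auto
  also have "word_inv x @ [] @ x = word_inv x @ x" by simp
  also have "pcong \<dots> []" using w by (intro pcong_word_inv)
  finally show ?thesis by (simp add: x_def y_def y'_def v'_def)
qed

text \<open>The elements congruent to the empty word form a normal subgroup containing the Peiffer
  elements, and \<open>N\<close> is the smallest such subgroup.\<close>

lemma pcong_N: "n \<in> N \<Longrightarrow> pcong n []"
proof -
  let ?M = "{w \<in> carrier H. pcong w []}"
  have sub: "subgroup ?M H"
  proof (rule H.subgroupI)
    have "[] \<in> ?M" by (simp add: H_iff pcong.refl)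
    then show "?M \<noteq> {}" by blast
    fix a assume "a \<in> ?M"
    then have a: "a \<in> carrier H" "pcong a []" "a \<in> xwords" by (auto intro: H_xwords)
    have "pcong (inv\<^bsub>H\<^esub> a) (word_inv a)" using a by (intro pcong_inv)
    also have "pcong (word_inv a) (word_inv a @ a)"
      using pcong_context[OF a(2), of "word_inv a" "[]"] a by (simp add: word_inv_in_lists pcong.sym)
    also have "pcong (word_inv a @ a) []" using a by (intro pcong_word_inv)
    finally show "inv\<^bsub>H\<^esub> a \<in> ?M" using a by simp
    fix b assume "b \<in> ?M"
    then have b: "b \<in> carrier H" "pcong b []" "b \<in> xwords" by (auto intro: H_xwords)
    have "pcong (a \<otimes>\<^bsub>H\<^esub> b) (a @ b)" using a b by (intro pcong_mult)
    also have "pcong (a @ b) ([] @ [])" using a b by (intro pcong_append)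
    finally show "a \<otimes>\<^bsub>H\<^esub> b \<in> ?M" using a b by simp
  qed auto
  have "?M \<lhd> H"
  proof (subst H.normal_inv_iff, intro conjI sub ballI)
    fix x n assume x: "x \<in> carrier H" and "n \<in> ?M"
    then have n: "n \<in> carrier H" "pcong n []" "n \<in> xwords" by (auto intro: H_xwords)
    let ?i = "inv\<^bsub>H\<^esub> x"
    have w: "x \<in> xwords" "?i \<in> xwords" "x \<otimes>\<^bsub>H\<^esub> n \<in> xwords" using x n by (auto intro: H_xwords)
    have "pcong (x \<otimes>\<^bsub>H\<^esub> n \<otimes>\<^bsub>H\<^esub> ?i) ((x \<otimes>\<^bsub>H\<^esub> n) @ ?i)" using w by (intro pcong_mult)
    also have "pcong ((x \<otimes>\<^bsub>H\<^esub> n) @ ?i) ((x @ n) @ ?i)"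
      using w n by (intro pcong_append pcong_mult pcong.refl)
    also have "(x @ n) @ ?i = x @ n @ ?i" by simp
    also have "pcong (x @ n @ ?i) (x @ [] @ ?i)" using w n by (intro pcong_context)
    also have "x @ [] @ ?i = x @ ?i" by simp
    also have "pcong (x @ ?i) (x \<otimes>\<^bsub>H\<^esub> ?i)" using w by (intro pcong.sym[OF pcong_mult])
    also have "x \<otimes>\<^bsub>H\<^esub> ?i = []" using x by (simp add: H_one)
    finally show "x \<otimes>\<^bsub>H\<^esub> n \<otimes>\<^bsub>H\<^esub> ?i \<in> ?M" using x n by simp
  qed
  moreover have "pcong e []" if "e \<in> peiffer_elements X R" for e
    using that by (auto simp: peiffer_elements_def Let_def intro!: pcong_peiffer_element)
  then have "peiffer_elements X R \<subseteq> ?M" using peiffer_elements_subset by blast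
  ultimately have "N \<subseteq> ?M" unfolding peiffer_subgroup_def by (intro hull_minimal)
  then show "n \<in> N \<Longrightarrow> pcong n []" by blast
qed

section \<open>Cosets as congruence classes\<close>

definition xcos :: "'x xgen word \<Rightarrow> 'x xgen word set"
  where "xcos w = N #>\<^bsub>H\<^esub> free_reduce w"

lemma free_reduce_H: "w \<in> xwords \<Longrightarrow> free_reduce w \<in> carrier H"
  by (simp add: H_eq free_reduce_closed)

lemma free_reduce_append_H: "free_reduce (v @ w) = free_reduce v \<otimes>\<^bsub>H\<^esub> free_reduce w"
  unfolding H_eq by (rule free_reduce_append_mult)

lemma xcos_append:
  "v \<in> xwords \<Longrightarrow> w \<in> xwords \<Longrightarrow> xcos v <#>\<^bsub>H\<^esub> xcos w = xcos (v @ w)"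
  by (simp add: xcos_def N.rcos_sum free_reduce_H free_reduce_append_H)

lemma pcong_xcos: "pcong v w \<Longrightarrow> xcos v = xcos w"
proof (induction rule: pcong.induct)
  case (cancel xs ys a)
  then show ?case
    by (simp add: xcos_def free_reduce_append reduce_Cons_cancel reduced_free_reduce)
next
  case (peiffer xs ys r s u v)
  define v' where "v' = v \<otimes>\<^bsub>F\<^esub> inv\<^bsub>F\<^esub> u \<otimes>\<^bsub>F\<^esub> rho_hat r \<otimes>\<^bsub>F\<^esub> u"
  define x y y' where "x = free_gen (r, u)" and "y = free_gen (s, v)" and "y' = free_gen (s, v')"
  have c: "x \<in> carrier H" "y \<in> carrier H" "y' \<in> carrier H"
    using peiffer by (simp_all add: x_def y_def y'_def v'_def gen_closed)
  let ?n = "inv\<^bsub>H\<^esub> x \<otimes>\<^bsub>H\<^esub> inv\<^bsub>H\<^esub> y \<otimes>\<^bsub>H\<^esub> x \<otimes>\<^bsub>H\<^esub> y'"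
  let ?A = "[((s, v), True), ((r, u), True)]" and ?B = "[((r, u), True), ((s, v'), True)]"
  have w: "?A \<in> xwords" "?B \<in> xwords" using peiffer by (simp_all add: v'_def)
  have "?n \<in> peiffer_elements X R"
    using peiffer unfolding peiffer_elements_def Let_def x_def y_def y'_def v'_def by blast
  then have "?n \<in> N" using peiffer_elements_N by blast
  \<comment> \<open>The Peiffer element satisfies \<open>(y x) ?n = x y'\<close>. Since right cosets
    carry \<open>N\<close> on the left, \<open>?n\<close> is first conjugated by \<open>y x\<close>,
    which normality permits.\<close>
  then have "y \<otimes>\<^bsub>H\<^esub> x \<otimes>\<^bsub>H\<^esub> ?n \<otimes>\<^bsub>H\<^esub> inv\<^bsub>H\<^esub> (y \<otimes>\<^bsub>H\<^esub> x) \<in> N"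
    using c by (intro N.inv_op_closed2) auto
  then have "(y \<otimes>\<^bsub>H\<^esub> x \<otimes>\<^bsub>H\<^esub> ?n \<otimes>\<^bsub>H\<^esub> inv\<^bsub>H\<^esub> (y \<otimes>\<^bsub>H\<^esub> x)) \<otimes>\<^bsub>H\<^esub> (y \<otimes>\<^bsub>H\<^esub> x) \<in> N #>\<^bsub>H\<^esub> (y \<otimes>\<^bsub>H\<^esub> x)"
    using c by (intro H.rcosI N.subset) auto
  moreover have "(y \<otimes>\<^bsub>H\<^esub> x \<otimes>\<^bsub>H\<^esub> ?n \<otimes>\<^bsub>H\<^esub> inv\<^bsub>H\<^esub> (y \<otimes>\<^bsub>H\<^esub> x)) \<otimes>\<^bsub>H\<^esub> (y \<otimes>\<^bsub>H\<^esub> x) = x \<otimes>\<^bsub>H\<^esub> y'"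
    using c by (simp add: H.m_assoc H.inv_mult_group H.inv_mult_cancel)
  ultimately have "N #>\<^bsub>H\<^esub> (y \<otimes>\<^bsub>H\<^esub> x) = N #>\<^bsub>H\<^esub> (x \<otimes>\<^bsub>H\<^esub> y')"
    using c N.subgroup_axioms by (intro H.repr_independence) auto
  moreover have "free_reduce ?A = y \<otimes>\<^bsub>H\<^esub> x" "free_reduce ?B = x \<otimes>\<^bsub>H\<^esub> y'"
    using free_reduce_append_H[of y x] free_reduce_append_H[of x y']
    by (simp_all add: x_def y_def y'_def free_gen_def)
  ultimately have "xcos ?A = xcos ?B" by (simp add: xcos_def)
  then have "xcos (xs @ ?A @ ys) = xcos (xs @ ?B @ ys)"
    using w peiffer xcos_append[of xs "?A @ ys"] xcos_append[of xs "?B @ ys"]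
      xcos_append[of ?A ys] xcos_append[of ?B ys] by simp
  then show ?case by (simp add: v'_def)
qed simp_all

text \<open>One inclusion is \<open>pcong_N\<close>, the other \<open>pcong_xcos\<close>. With
  cosets known as sets of reduced words, the boundary and the action of \<open>derived_xmod\<close>,
  which are defined by images of sets, can be computed.\<close>

lemma xcos_eq:
  assumes "w \<in> xwords"
  shows "xcos w = {x \<in> carrier H. pcong x w}"
proof (intro subset_antisym subsetI)
  fix x assume "x \<in> xcos w"
  then obtain n where n: "n \<in> N" "x = n \<otimes>\<^bsub>H\<^esub> free_reduce w"
    by (auto simp: xcos_def r_coset_def)
  have nH: "n \<in> carrier H" using n N.subset by blast
  have "pcong x (n @ free_reduce w)"
    unfolding n(2) using nH assms by (simp add: pcong_mult H_xwords free_reduce_H)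
  also have "pcong (n @ free_reduce w) ([] @ w)"
    using n assms by (intro pcong_append pcong_N pcong.sym[OF pcong_free_reduce])
  finally show "x \<in> {x \<in> carrier H. pcong x w}"
    using n nH assms by (simp add: free_reduce_H)
next
  fix x assume "x \<in> {x \<in> carrier H. pcong x w}"
  then have x: "x \<in> carrier H" "pcong x w" by auto
  have "free_reduce x = x" using x by (simp add: H_iff free_reduce_reduced)
  then have "x \<in> xcos x"
    using x N.subgroup_axioms by (simp add: xcos_def H.rcos_self)
  then show "x \<in> xcos w" using pcong_xcos[OF x(2)] by simp
qed

lemma xcos_nonempty: "w \<in> xwords \<Longrightarrow> free_reduce w \<in> xcos w"
  by (simp add: xcos_eq free_reduce_H pcong.sym[OF pcong_free_reduce])

lemma xcos_eq_iff:
  assumes "v \<in> xwords" "w \<in> xwords"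
  shows "xcos v = xcos w \<longleftrightarrow> pcong v w"
proof
  assume "xcos v = xcos w"
  then have "pcong (free_reduce v) w"
    using xcos_nonempty[OF assms(1)] assms by (simp add: xcos_eq)
  then show "pcong v w" using pcong_free_reduce[OF assms(1)] by (rule pcong.trans[rotated])
qed (rule pcong_xcos)

text \<open>Right translation by \<open>g\<close> is injective on F(X), so it creates no new
  cancelling pair. This is why the action on cosets can be a plain \<open>map\<close> without
  reduction.\<close>

lemma shift_H:
  assumes "x \<in> carrier H" "g \<in> carrier F"
  shows "shift g x \<in> carrier H"
proof -
  have "reduced (shift g w)" if "reduced w" "w \<in> xwords" for w
    using that
  proof (induction w rule: induct_list012)
    case (3 a b w)
    obtain r u c s v d where ab: "a = ((r, u), c)" "b = ((s, v), d)" by (metis prod.exhaust)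
    have "v \<otimes>\<^bsub>F\<^esub> g \<noteq> u \<otimes>\<^bsub>F\<^esub> g" if "v \<noteq> u" using 3 that assms by (simp add: ab)
    then show ?case using 3 by (auto simp: ab letter_inv_def)
  qed (auto simp: shift_def)
  then show ?thesis using assms by (simp add: H_iff)
qed

lemma shift_xcos:
  assumes "w \<in> xwords" "g \<in> carrier F"
  shows "shift g ` xcos w = xcos (shift g w)"
proof -
  have *: "shift h x \<in> xcos (shift h v)" if "x \<in> xcos v" "v \<in> xwords" "h \<in> carrier F" for x v h
    using that by (simp add: xcos_eq shift_H pcong_shift)
  have "x \<in> shift g ` xcos w" if x: "x \<in> xcos (shift g w)" for x
  proof
    \<comment> \<open>The preimage is obtained by translating back with the inverse of
      \<open>g\<close>.\<close>
    show "shift (inv\<^bsub>F\<^esub> g) x \<in> xcos w"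
      using *[OF x, of "inv\<^bsub>F\<^esub> g"] assms by simp
    have "x \<in> xwords" using x assms by (simp add: xcos_eq H_xwords)
    then show "x = shift g (shift (inv\<^bsub>F\<^esub> g) x)" using assms by simp
  qed
  with * assms show ?thesis by blast
qed

lemma word_xmod_derived: "word_xmod X R (derived_xmod X R) xcos"
proof unfold_locales
  show "carrier (derived_xmod X R) = xcos ` xwords"
  proof -
    have "free_reduce ` xwords = carrier H"
      by (force simp: H_iff free_reduce_reduced reduced_free_reduce free_reduce_in_lists image_iff)
    then show ?thesis
      by (auto simp: derived_xmod_def Let_def FactGroup_def RCOSETS_def xcos_def
          simp flip: \<open>free_reduce ` xwords = carrier H\<close>)
  qed
  show "\<one>\<^bsub>derived_xmod X R\<^esub> = xcos []"
    using H.coset_mult_one[OF N.subset]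
    by (simp add: derived_xmod_def Let_def FactGroup_def xcos_def H_one)
  fix w assume w: "w \<in> xwords"
  show "xcos w \<otimes>\<^bsub>derived_xmod X R\<^esub> xcos v = xcos (w @ v)" if "v \<in> xwords" for v
    using w that by (simp add: derived_xmod_def Let_def FactGroup_def xcos_append)
  show "xcos w = xcos v \<longleftrightarrow> pcong w v" if "v \<in> xwords" for v
    using w that by (rule xcos_eq_iff)
  \<comment> \<open>The use of \<open>the_elem\<close> in the boundary requires this image to be a
    singleton: \<open>xbd\<close> is constant on the class, and the class is nonempty.\<close>
  have "xbd ` xcos w = (\<lambda>_. xbd w) ` xcos w"
    using w pcong_xbd by (intro image_cong) (auto simp: xcos_eq)
  also have "\<dots> = {xbd w}" using xcos_nonempty[OF w] by blast
  finally show "bd (derived_xmod X R) (xcos w) = xbd w"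
    by (simp add: derived_xmod_def Let_def flip: xbd_def)
  show "act (derived_xmod X R) (xcos w) g = xcos (shift g w)" if "g \<in> carrier F" for g
    using shift_xcos[OF w that] by (simp add: derived_xmod_def Let_def shift_def)
qed

end

section \<open>The crossed module of the reduced Squier complex\<close>

context presentation
begin

abbreviation K :: "('x word, 'x sq_edge) complex2" where "K \<equiv> squier X R"

lemma K_simps [simp]:
  "verts K = carrier F"
  "(p, l, r, q) \<in> edges K \<longleftrightarrow> p \<in> carrier F \<and> q \<in> carrier F \<and> (l, r) \<in> R"
  "esrc K (p, l, r, q) = p \<otimes>\<^bsub>F\<^esub> free_reduce l \<otimes>\<^bsub>F\<^esub> q"
  "etgt K (p, l, r, q) = p \<otimes>\<^bsub>F\<^esub> free_reduce r \<otimes>\<^bsub>F\<^esub> q"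
  by (simp_all add: squier_def Let_def)

lemma osrc_closed: "fst a \<in> edges K \<Longrightarrow> osrc K a \<in> carrier F"
  by (cases a; cases "fst a") (auto simp: osrc_def)

lemma walk_start_closed: "walk K p as \<Longrightarrow> p \<in> carrier F"
  by (cases as) (auto simp: osrc_closed)

lemma walk_append_K: "walk K p (as @ bs) \<longleftrightarrow> walk K p as \<and> walk K (walk_end K p as) bs"
  by (induction as arbitrary: p) (auto simp: walk_start_closed)

text \<open>Forgetting the first component of every edge turns a walk into a word. The walk is
  recovered from its start vertex, since an edge is determined by its last three components
  together with one of its end points.\<close>

definition forget :: "('x sq_edge \<times> bool) list \<Rightarrow> 'x xgen word"
  where "forget = map (\<lambda>((p, l, r, q), b). (((l, r), q), b))"

text \<open>The first component of the edge solves \<open>p = p' l q\<close> for \<open>p'\<close>,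
  or \<open>p = p' r q\<close> when the edge is traversed backwards.\<close>

fun lift_word :: "'x word \<Rightarrow> 'x xgen word \<Rightarrow> ('x sq_edge \<times> bool) list" where
  "lift_word p [] = []"
| "lift_word p ((((l, r), q), b) # w) =
    ((p \<otimes>\<^bsub>F\<^esub> inv\<^bsub>F\<^esub> (free_reduce (if b then l else r) \<otimes>\<^bsub>F\<^esub> q), l, r, q), b) #
    lift_word (p \<otimes>\<^bsub>F\<^esub> xbd [(((l, r), q), b)]) w"

lemma forget_simps [simp]:
  "forget [] = []"
  "forget (((p, l, r, q), b) # as) = (((l, r), q), b) # forget as"
  "forget (as @ bs) = forget as @ forget bs"
  by (simp_all add: forget_def)

lemma xbd_edge:
  assumes "(l, r) \<in> R" "q \<in> carrier F"
  shows "xbd [(((l, r), q), True)] =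
      inv\<^bsub>F\<^esub> q \<otimes>\<^bsub>F\<^esub> inv\<^bsub>F\<^esub> free_reduce l \<otimes>\<^bsub>F\<^esub> free_reduce r \<otimes>\<^bsub>F\<^esub> q"
    and "xbd [(((l, r), q), False)] =
      inv\<^bsub>F\<^esub> q \<otimes>\<^bsub>F\<^esub> inv\<^bsub>F\<^esub> free_reduce r \<otimes>\<^bsub>F\<^esub> free_reduce l \<otimes>\<^bsub>F\<^esub> q"
  using assms by (simp_all add: xbd_letter rho_hat_eq F_simps)

lemma lift_word_walk:
  "w \<in> xwords \<Longrightarrow> p \<in> carrier F \<Longrightarrow> walk K p (lift_word p w) \<and> forget (lift_word p w) = w"
proof (induction p w rule: lift_word.induct)
  case (2 p l r q b w)
  let ?e = "(p \<otimes>\<^bsub>F\<^esub> inv\<^bsub>F\<^esub> (free_reduce (if b then l else r) \<otimes>\<^bsub>F\<^esub> q), l, r, q)"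
  have lrq: "(l, r) \<in> R" "q \<in> carrier F" "w \<in> xwords" using 2 by auto
  have "otgt K (?e, b) = p \<otimes>\<^bsub>F\<^esub> xbd [(((l, r), q), b)]" "osrc K (?e, b) = p"
    using lrq 2 by (cases b; simp add: otgt_def osrc_def xbd_edge F_simps)+
  then show ?case using lrq 2 by (cases b) simp_all
qed simp

text \<open>Since \<open>p' r q = (p' l q) (q\<inverse> l\<inverse> r q)\<close>, traversing an edge
  multiplies the current vertex on the right by the boundary of the label. The range of a walk thus
  depends only on its start and its label.\<close>

lemma walk_word:
  "walk K p as \<Longrightarrow>
    forget as \<in> xwords \<and> lift_word p (forget as) = as \<and> walk_end K p as = p \<otimes>\<^bsub>F\<^esub> xbd (forget as)"
proof (induction as arbitrary: p)
  case (Cons a as)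
  obtain p' l r q b where a: "a = ((p', l, r, q), b)" by (metis prod.exhaust)
  let ?x = "(((l, r), q), b)"
  have e: "p' \<in> carrier F" "q \<in> carrier F" "(l, r) \<in> R" and p: "p = osrc K a"
    and w: "walk K (otgt K a) as"
    using Cons.prems by (auto simp: a)
  have p_closed: "p \<in> carrier F" using Cons.prems by (rule walk_start_closed)
  have x: "?x \<in> letters gens" using e by simp
  have "otgt K a = p \<otimes>\<^bsub>F\<^esub> xbd [?x]"
    "p \<otimes>\<^bsub>F\<^esub> inv\<^bsub>F\<^esub> (free_reduce (if b then l else r) \<otimes>\<^bsub>F\<^esub> q) = p'"
    using e by (cases b; simp add: p a otgt_def osrc_def xbd_edge F_simps)+
  then show ?case
    using Cons.IH[OF w] x p_closed e xbd_Cons[of ?x "forget as"] xbd_closed[of "[?x]"]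
    by (simp add: a F.m_assoc)
qed simp

lemmas forget_xwords = walk_word[THEN conjunct1]
  and lift_word_forget = walk_word[THEN conjunct2, THEN conjunct1]
  and walk_end_eq = walk_word[THEN conjunct2, THEN conjunct2]

lemma lift_word_append:
  "v \<in> xwords \<Longrightarrow> w \<in> xwords \<Longrightarrow> p \<in> carrier F \<Longrightarrow>
    lift_word p (v @ w) = lift_word p v @ lift_word (p \<otimes>\<^bsub>F\<^esub> xbd v) w"
proof (induction p v rule: lift_word.induct)
  case (2 p l r q b v)
  then show ?case
    using xbd_Cons[of "(((l, r), q), b)" v] xbd_closed[of "[(((l, r), q), b)]"]
    by (simp add: F.m_assoc)
qed simp

section \<open>Two-cells and Peiffer relations\<close>

lemma cells_KI:
  assumes "p \<in> carrier F" "q \<in> carrier F" "p' \<in> carrier F" "q' \<in> carrier F"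
    and "(l, r) \<in> R" "(l', r') \<in> R"
  shows "([((p, l, r, q \<otimes>\<^bsub>F\<^esub> p' \<otimes>\<^bsub>F\<^esub> free_reduce l' \<otimes>\<^bsub>F\<^esub> q'), True),
      ((p \<otimes>\<^bsub>F\<^esub> free_reduce r \<otimes>\<^bsub>F\<^esub> q \<otimes>\<^bsub>F\<^esub> p', l', r', q'), True)],
    [((p \<otimes>\<^bsub>F\<^esub> free_reduce l \<otimes>\<^bsub>F\<^esub> q \<otimes>\<^bsub>F\<^esub> p', l', r', q'), True),
      ((p, l, r, q \<otimes>\<^bsub>F\<^esub> p' \<otimes>\<^bsub>F\<^esub> free_reduce r' \<otimes>\<^bsub>F\<^esub> q'), True)]) \<in> cells K"
  using assms unfolding squier_def Let_def complex2.simps by blast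

lemma lift_word_cell:
  assumes "(l, r) \<in> R" "(l', r') \<in> R" "u \<in> carrier F" "v \<in> carrier F" "p \<in> carrier F"
  shows "(lift_word p [(((l, r), v), True), (((l', r'), u), True)],
    lift_word p [(((l', r'), u), True),
      (((l, r), v \<otimes>\<^bsub>F\<^esub> inv\<^bsub>F\<^esub> u \<otimes>\<^bsub>F\<^esub> rho_hat (l', r') \<otimes>\<^bsub>F\<^esub> u), True)]) \<in> cells K"
proof -
  \<comment> \<open>\<open>?p0\<close> comes from the start vertex, \<open>p = ?p0 l v\<close>, and
    \<open>?q0\<close> from \<open>v = ?q0 l' u\<close>. Only the product \<open>q p'\<close> enters
    a 2-cell, so \<open>p'\<close> is taken to be \<open>1\<close>.\<close>
  let ?p0 = "p \<otimes>\<^bsub>F\<^esub> inv\<^bsub>F\<^esub> v \<otimes>\<^bsub>F\<^esub> inv\<^bsub>F\<^esub> free_reduce l"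
  let ?q0 = "v \<otimes>\<^bsub>F\<^esub> inv\<^bsub>F\<^esub> u \<otimes>\<^bsub>F\<^esub> inv\<^bsub>F\<^esub> free_reduce l'"
  have "lift_word p [(((l, r), v), True), (((l', r'), u), True)] =
    [((?p0, l, r, ?q0 \<otimes>\<^bsub>F\<^esub> \<one>\<^bsub>F\<^esub> \<otimes>\<^bsub>F\<^esub> free_reduce l' \<otimes>\<^bsub>F\<^esub> u), True),
     ((?p0 \<otimes>\<^bsub>F\<^esub> free_reduce r \<otimes>\<^bsub>F\<^esub> ?q0 \<otimes>\<^bsub>F\<^esub> \<one>\<^bsub>F\<^esub>, l', r', u), True)]"
    using assms by (simp add: xbd_edge F_simps)
  moreover have "lift_word p [(((l', r'), u), True),
      (((l, r), v \<otimes>\<^bsub>F\<^esub> inv\<^bsub>F\<^esub> u \<otimes>\<^bsub>F\<^esub> rho_hat (l', r') \<otimes>\<^bsub>F\<^esub> u), True)] =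
    [((?p0 \<otimes>\<^bsub>F\<^esub> free_reduce l \<otimes>\<^bsub>F\<^esub> ?q0 \<otimes>\<^bsub>F\<^esub> \<one>\<^bsub>F\<^esub>, l', r', u), True),
     ((?p0, l, r, ?q0 \<otimes>\<^bsub>F\<^esub> \<one>\<^bsub>F\<^esub> \<otimes>\<^bsub>F\<^esub> free_reduce r' \<otimes>\<^bsub>F\<^esub> u), True)]"
    using assms by (simp add: xbd_edge rho_hat_eq F_simps)
  moreover have "?p0 \<in> carrier F" "?q0 \<in> carrier F" using assms by simp_all
  ultimately show ?thesis
    using cells_KI[of ?p0 ?q0 "\<one>\<^bsub>F\<^esub>" u l r l' r'] assms by (simp only: F.one_closed)
qed

lemma pcong_homotopy:
  assumes "pcong v w" "p \<in> carrier F"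
  shows "((p, lift_word p v), (p, lift_word p w)) \<in> homotopy K"
  using assms(1)
proof (induction rule: pcong.induct)
  case (refl w)
  then show ?case
    using assms lift_word_walk by (auto simp: epaths_def intro: homotopy.refl)
next
  case (sym v w)
  then show ?case by (blast intro: homotopy.sym)
next
  case (trans u v w)
  then show ?case by (blast intro: homotopy.trans)
next
  case (cancel xs ys a)
  obtain l r q b where a: "a = (((l, r), q), b)" by (metis prod.exhaust)
  let ?p = "p \<otimes>\<^bsub>F\<^esub> xbd xs"
  let ?e = "(?p \<otimes>\<^bsub>F\<^esub> inv\<^bsub>F\<^esub> (free_reduce (if b then l else r) \<otimes>\<^bsub>F\<^esub> q), l, r, q)"
  have lrq: "(l, r) \<in> R" "q \<in> carrier F" using cancel by (auto simp: a)
  \<comment> \<open>The lifts of \<open>a\<close> and of its inverse are one edge run through in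
    both directions, which returns to \<open>?p\<close> before \<open>ys\<close> is lifted.\<close>
  have "lift_word ?p ([a, letter_inv a] @ ys) = [(?e, b), (?e, \<not> b)] @ lift_word ?p ys"
    using lrq cancel assms by (cases b) (simp_all add: a letter_inv_def xbd_edge F_simps)
  then have eq: "lift_word p (xs @ [a, letter_inv a] @ ys) =
      lift_word p xs @ [(?e, b), (?e, \<not> b)] @ lift_word ?p ys"
    using cancel assms lift_word_append[of xs "[a, letter_inv a] @ ys" p] by simp
  have "(p, lift_word p (xs @ [a, letter_inv a] @ ys)) \<in> epaths K"
    using lift_word_walk[of "xs @ [a, letter_inv a] @ ys" p] cancel assms
    by (simp add: epaths_def)
  then show ?case
    unfolding eq lift_word_append[OF cancel(1,2) assms(2)] by (rule homotopy.cancel)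
next
  case (peiffer xs ys r s u v)
  obtain l' r' l r0 where rs: "r = (l', r')" "s = (l, r0)" by fastforce
  define v' where "v' = v \<otimes>\<^bsub>F\<^esub> inv\<^bsub>F\<^esub> u \<otimes>\<^bsub>F\<^esub> rho_hat r \<otimes>\<^bsub>F\<^esub> u"
  let ?p = "p \<otimes>\<^bsub>F\<^esub> xbd xs"
  let ?A = "[((s, v), True), ((r, u), True)]" and ?B = "[((r, u), True), ((s, v'), True)]"
  have AB: "?A \<in> xwords" "?B \<in> xwords" using peiffer by (simp_all add: v'_def)
  \<comment> \<open>Equal boundaries make both lifts arrive at the same vertex, so the lifts of
    \<open>ys\<close> after them coincide.\<close>
  have "xbd ?A = xbd ?B"
    using pcong_xbd[OF pcong.peiffer[of "[]" "[]" r s u v]] peiffer by (simp add: v'_def)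
  then have eq: "lift_word p (xs @ ?A @ ys) =
      lift_word p xs @ lift_word ?p ?A @ lift_word (?p \<otimes>\<^bsub>F\<^esub> xbd ?A) ys"
    "lift_word p (xs @ ?B @ ys) =
      lift_word p xs @ lift_word ?p ?B @ lift_word (?p \<otimes>\<^bsub>F\<^esub> xbd ?A) ys"
    using AB peiffer(1,2) assms(2) lift_word_append[of xs "?A @ ys" p]
      lift_word_append[of xs "?B @ ys" p] lift_word_append[of ?A ys ?p] lift_word_append[of ?B ys ?p]
    by simp_all
  have "(lift_word ?p ?A, lift_word ?p ?B) \<in> cells K"
    unfolding rs v'_def
    by (rule lift_word_cell) (use peiffer assms in \<open>auto simp: rs\<close>)
  moreover have "(p, lift_word p (xs @ ?A @ ys)) \<in> epaths K"
    using lift_word_walk[of "xs @ ?A @ ys" p] AB peiffer assms by (simp add: epaths_def)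
  ultimately have "((p, lift_word p (xs @ ?A @ ys)), (p, lift_word p (xs @ ?B @ ys))) \<in> homotopy K"
    unfolding eq by (rule homotopy.cell)
  then show ?case by (simp add: v'_def)
qed

text \<open>The converse of \<open>lift_word_cell\<close>. The rule \<open>homotopy.cell\<close>
  demands an edge path only on the side of \<open>c\<close>; the last conclusion transfers this to
  \<open>d\<close>.\<close>

lemma cells_K:
  assumes "(c, d) \<in> cells K"
  obtains l r l' r' u v where "(l, r) \<in> R" "(l', r') \<in> R" "u \<in> carrier F" "v \<in> carrier F"
    "forget c = [(((l, r), v), True), (((l', r'), u), True)]"
    "forget d = [(((l', r'), u), True),
      (((l, r), v \<otimes>\<^bsub>F\<^esub> inv\<^bsub>F\<^esub> u \<otimes>\<^bsub>F\<^esub> rho_hat (l', r') \<otimes>\<^bsub>F\<^esub> u), True)]"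
    "\<forall>z. walk K z c \<longrightarrow> walk K z d \<and> walk_end K z d = walk_end K z c"
proof -
  from assms obtain p q p' q' l r l' r' where
    c: "p \<in> carrier F" "q \<in> carrier F" "p' \<in> carrier F" "q' \<in> carrier F" "(l, r) \<in> R" "(l', r') \<in> R"
    and cd: "c = [((p, l, r, q \<otimes>\<^bsub>F\<^esub> p' \<otimes>\<^bsub>F\<^esub> free_reduce l' \<otimes>\<^bsub>F\<^esub> q'), True),
                 ((p \<otimes>\<^bsub>F\<^esub> free_reduce r \<otimes>\<^bsub>F\<^esub> q \<otimes>\<^bsub>F\<^esub> p', l', r', q'), True)]"
      "d = [((p \<otimes>\<^bsub>F\<^esub> free_reduce l \<otimes>\<^bsub>F\<^esub> q \<otimes>\<^bsub>F\<^esub> p', l', r', q'), True),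
                 ((p, l, r, q \<otimes>\<^bsub>F\<^esub> p' \<otimes>\<^bsub>F\<^esub> free_reduce r' \<otimes>\<^bsub>F\<^esub> q'), True)]"
    unfolding squier_def Let_def by auto
  show thesis
  \<comment> \<open>With \<open>u = q'\<close> and \<open>v = q p' l' q'\<close>, the translated
    exponent \<open>v (inv u) (inv l') r' u\<close> is \<open>q p' r' q'\<close>, as in the
    2-cell.\<close>
  proof (rule that[of l r l' r' q' "q \<otimes>\<^bsub>F\<^esub> p' \<otimes>\<^bsub>F\<^esub> free_reduce l' \<otimes>\<^bsub>F\<^esub> q'"])
    show "\<forall>z. walk K z c \<longrightarrow> walk K z d \<and> walk_end K z d = walk_end K z c"
      using c by (simp add: cd osrc_def otgt_def F_simps)
  qed (use c in \<open>simp_all add: cd rho_hat_eq F_simps\<close>)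
qed

lemma homotopy_pcong:
  "(P, Q) \<in> homotopy K \<Longrightarrow>
    fst P = fst Q \<and> P \<in> epaths K \<and> Q \<in> epaths K \<and> pcong (forget (snd P)) (forget (snd Q))"
proof (induction rule: homotopy.induct)
  case (refl P)
  then show ?case by (auto simp: epaths_def intro!: pcong.refl dest: forget_xwords)
next
  case (sym P Q)
  then show ?case by (auto intro: pcong.sym)
next
  case (trans P Q S)
  then show ?case by (auto intro: pcong.trans)
next
  case (cancel p as e b bs)
  obtain p' l r q where e: "e = (p', l, r, q)" by (metis prod.exhaust)
  have w: "walk K p (as @ [(e, b), (e, \<not> b)] @ bs)" using cancel by (simp add: epaths_def)
  then have *: "walk K p (as @ bs)"
    by (cases b) (auto simp: walk_append_K osrc_def otgt_def)
  have "pcong (forget as @ [(((l, r), q), b), letter_inv (((l, r), q), b)] @ forget bs)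
      (forget as @ forget bs)"
    using w forget_xwords[OF *]
    by (intro pcong.cancel) (auto simp: walk_append_K e)
  with w * show ?case by (simp add: epaths_def e letter_inv_def)
next
  case (cell c d p as bs)
  obtain l r l' r' u v where lr: "(l, r) \<in> R" "(l', r') \<in> R" "u \<in> carrier F" "v \<in> carrier F"
    and fc: "forget c = [(((l, r), v), True), (((l', r'), u), True)]"
    and fd: "forget d = [(((l', r'), u), True),
      (((l, r), v \<otimes>\<^bsub>F\<^esub> inv\<^bsub>F\<^esub> u \<otimes>\<^bsub>F\<^esub> rho_hat (l', r') \<otimes>\<^bsub>F\<^esub> u), True)]"
    and end_eq: "\<forall>z. walk K z c \<longrightarrow> walk K z d \<and> walk_end K z d = walk_end K z c"
    by (rule cells_K[OF cell(1)])
  have w: "walk K p (as @ c @ bs)" using cell by (simp add: epaths_def)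
  then have "walk K p (as @ d @ bs)"
    using end_eq by (auto simp: walk_append_K)
  moreover have "pcong (forget as @ forget c @ forget bs) (forget as @ forget d @ forget bs)"
    unfolding fc fd using forget_xwords[OF w] lr by (intro pcong.peiffer) auto
  ultimately show ?case using w by (simp add: epaths_def)
qed

section \<open>Homotopy classes as congruence classes of labels\<close>

definition hcls :: "'x word \<Rightarrow> 'x xgen word \<Rightarrow> ('x word, 'x sq_edge) epath set"
  where "hcls p w = {(p, as) | as. walk K p as \<and> pcong (forget as) w}"

text \<open>A path is the lift of its label, so \<open>pcong_homotopy\<close> and
  \<open>homotopy_pcong\<close> together say that homotopy means equal start and congruent
  labels.\<close>

lemma homotopy_class:
  assumes "walk K p as"
  shows "homotopy K `` {(p, as)} = hcls p (forget as)"
proof (intro subset_antisym subsetI)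
  fix Q assume "Q \<in> homotopy K `` {(p, as)}"
  then have "((p, as), Q) \<in> homotopy K" by simp
  from homotopy_pcong[OF this] show "Q \<in> hcls p (forget as)"
    by (cases Q) (auto simp: hcls_def epaths_def intro: pcong.sym)
next
  fix Q assume "Q \<in> hcls p (forget as)"
  then obtain bs where Q: "Q = (p, bs)" "walk K p bs" "pcong (forget as) (forget bs)"
    by (auto simp: hcls_def intro: pcong.sym)
  then show "Q \<in> homotopy K `` {(p, as)}"
    using pcong_homotopy[OF Q(3) walk_start_closed[OF assms]] lift_word_forget assms by simp
qed

lemma hcls_lift:
  assumes "p \<in> carrier F" "w \<in> xwords"
  shows "hcls p w = homotopy K `` {(p, lift_word p w)}"
  using homotopy_class[of p "lift_word p w"] lift_word_walk assms by simp

lemma lift_word_hcls: "p \<in> carrier F \<Longrightarrow> w \<in> xwords \<Longrightarrow> (p, lift_word p w) \<in> hcls p w"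
  by (simp add: hcls_def lift_word_walk pcong.refl)

lemma hcls_cong: "pcong v w \<Longrightarrow> hcls p v = hcls p w"
  unfolding hcls_def by (blast intro: pcong.trans pcong.sym)

lemma hcls_eq_iff:
  assumes "p \<in> carrier F" "v \<in> xwords" "w \<in> xwords"
  shows "hcls p v = hcls p w \<longleftrightarrow> pcong v w"
proof
  assume "hcls p v = hcls p w"
  then have "(p, lift_word p v) \<in> hcls p w" using lift_word_hcls assms by blast
  then show "pcong v w" using assms lift_word_walk by (simp add: hcls_def)
qed (rule hcls_cong)

lemma groupoid_mors_K: "groupoid_mors K = {hcls p w | p w. p \<in> carrier F \<and> w \<in> xwords}"
proof (intro subset_antisym subsetI)
  fix \<alpha> assume "\<alpha> \<in> groupoid_mors K"
  then obtain P where "P \<in> epaths K" "\<alpha> = homotopy K `` {P}"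
    unfolding groupoid_mors_def by (rule quotientE)
  then obtain p as where "walk K p as" "\<alpha> = homotopy K `` {(p, as)}"
    by (auto simp: epaths_def)
  then show "\<alpha> \<in> {hcls p w | p w. p \<in> carrier F \<and> w \<in> xwords}"
    using homotopy_class walk_start_closed forget_xwords by blast
next
  fix \<alpha> assume "\<alpha> \<in> {hcls p w | p w. p \<in> carrier F \<and> w \<in> xwords}"
  then obtain p w where pw: "\<alpha> = hcls p w" "p \<in> carrier F" "w \<in> xwords" by blast
  then have "(p, lift_word p w) \<in> epaths K" by (simp add: lift_word_walk epaths_def)
  then show "\<alpha> \<in> groupoid_mors K"
    unfolding pw(1) hcls_lift[OF pw(2,3)] groupoid_mors_def by (rule quotientI)
qed

lemma mor_dom_hcls:
  assumes "p \<in> carrier F" "w \<in> xwords"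
  shows "mor_dom (hcls p w) = p"
proof -
  have "fst ` hcls p w = (\<lambda>_. p) ` hcls p w" by (intro image_cong) (auto simp: hcls_def)
  also have "\<dots> = {p}" using lift_word_hcls[OF assms] by blast
  finally show ?thesis by (simp add: mor_dom_def)
qed

lemma mor_ran_hcls:
  assumes "p \<in> carrier F" "w \<in> xwords"
  shows "mor_ran K (hcls p w) = p \<otimes>\<^bsub>F\<^esub> xbd w"
proof -
  have "(\<lambda>(v, as). walk_end K v as) ` hcls p w = (\<lambda>_. p \<otimes>\<^bsub>F\<^esub> xbd w) ` hcls p w"
    by (intro image_cong) (auto simp: hcls_def walk_end_eq pcong_xbd)
  also have "\<dots> = {p \<otimes>\<^bsub>F\<^esub> xbd w}" using lift_word_hcls[OF assms] by blast
  finally show ?thesis by (simp add: mor_ran_def)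
qed

lemma star_K: "star K \<one>\<^bsub>F\<^esub> = hcls \<one>\<^bsub>F\<^esub> ` xwords"
  by (auto simp: star_def groupoid_mors_K mor_dom_hcls)

text \<open>By \<open>*\<close> every term of the double union is the same class; the lifted words
  in \<open>l\<close> show that the union has at least one term.\<close>

lemma mor_comp_hcls:
  assumes "p \<in> carrier F" "v \<in> xwords" "w \<in> xwords"
  shows "mor_comp K (hcls p v) (hcls (p \<otimes>\<^bsub>F\<^esub> xbd v) w) = hcls p (v @ w)"
proof -
  have *: "homotopy K `` {(p, as @ bs)} = hcls p (v @ w)"
    if as: "(p, as) \<in> hcls p v" and bs: "(p \<otimes>\<^bsub>F\<^esub> xbd v, bs) \<in> hcls (p \<otimes>\<^bsub>F\<^esub> xbd v) w" for as bs
  proof -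
    have ab: "walk K p as" "walk K (p \<otimes>\<^bsub>F\<^esub> xbd v) bs" "pcong (forget as) v" "pcong (forget bs) w"
      using as bs by (auto simp: hcls_def)
    then have "walk K p (as @ bs)" by (simp add: walk_append_K walk_end_eq pcong_xbd)
    then show ?thesis
      using hcls_cong[OF pcong_append[OF ab(3,4)]] homotopy_class by simp
  qed
  have l: "(p, lift_word p v) \<in> hcls p v"
    "(p \<otimes>\<^bsub>F\<^esub> xbd v, lift_word (p \<otimes>\<^bsub>F\<^esub> xbd v) w) \<in> hcls (p \<otimes>\<^bsub>F\<^esub> xbd v) w"
    using assms by (simp_all add: lift_word_hcls)
  have fst_hcls: "a = q" if "(a, as) \<in> hcls q u" for a as q u using that by (simp add: hcls_def)
  show ?thesis
  proof (intro subset_antisym subsetI)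
    fix P assume "P \<in> mor_comp K (hcls p v) (hcls (p \<otimes>\<^bsub>F\<^esub> xbd v) w)"
    then obtain a as b bs where ab: "(a, as) \<in> hcls p v" "(b, bs) \<in> hcls (p \<otimes>\<^bsub>F\<^esub> xbd v) w"
      "P \<in> homotopy K `` {(a, as @ bs)}"
      unfolding mor_comp_def by blast
    then show "P \<in> hcls p (v @ w)" using * fst_hcls by metis
  next
    fix P assume "P \<in> hcls p (v @ w)"
    then have "P \<in> homotopy K `` {(p, lift_word p v @ lift_word (p \<otimes>\<^bsub>F\<^esub> xbd v) w)}"
      unfolding *[OF l] .
    with l show "P \<in> mor_comp K (hcls p v) (hcls (p \<otimes>\<^bsub>F\<^esub> xbd v) w)"
      unfolding mor_comp_def by blast
  qed
qed

section \<open>Translations of paths and homotopy classes\<close>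

lemma edge_lact_apply: "edge_lact X u (p, l, r, q) = (u \<otimes>\<^bsub>F\<^esub> p, l, r, q)"
  by (simp add: edge_lact_def)

lemma edge_ract_apply: "edge_ract X (p, l, r, q) u = (p, l, r, q \<otimes>\<^bsub>F\<^esub> u)"
  by (simp add: edge_ract_def)

lemma edge_lact_walk:
  assumes "u \<in> carrier F"
  shows "walk K p as \<Longrightarrow> walk K (u \<otimes>\<^bsub>F\<^esub> p) (map (\<lambda>(e, b). (edge_lact X u e, b)) as) \<and>
    forget (map (\<lambda>(e, b). (edge_lact X u e, b)) as) = forget as"
proof (induction as arbitrary: p)
  case (Cons a as)
  obtain p' l r q b where a: "a = ((p', l, r, q), b)" by (metis prod.exhaust)
  show ?case
    using Cons.prems Cons.IH[of "otgt K a"] assms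
    by (cases b) (auto simp: a edge_lact_apply osrc_def otgt_def F.m_assoc)
qed (use assms in simp)

lemma edge_ract_walk:
  assumes "u \<in> carrier F"
  shows "walk K p as \<Longrightarrow> walk K (p \<otimes>\<^bsub>F\<^esub> u) (map (\<lambda>(e, b). (edge_ract X e u, b)) as) \<and>
    forget (map (\<lambda>(e, b). (edge_ract X e u, b)) as) = shift u (forget as)"
proof (induction as arbitrary: p)
  case (Cons a as)
  obtain p' l r q b where a: "a = ((p', l, r, q), b)" by (metis prod.exhaust)
  show ?case
    using Cons.prems Cons.IH[of "otgt K a"] assms
    by (cases b) (auto simp: a edge_ract_apply osrc_def otgt_def F.m_assoc)
qed (use assms in simp)

lemma mor_lact_hcls:
  assumes "u \<in> carrier F" "p \<in> carrier F" "w \<in> xwords"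
  shows "mor_lact X u (hcls p w) = hcls (u \<otimes>\<^bsub>F\<^esub> p) w"
proof (intro subset_antisym subsetI)
  fix P assume "P \<in> mor_lact X u (hcls p w)"
  then show "P \<in> hcls (u \<otimes>\<^bsub>F\<^esub> p) w"
    using edge_lact_walk[OF assms(1)] by (auto simp: mor_lact_def hcls_def)
next
  fix P assume "P \<in> hcls (u \<otimes>\<^bsub>F\<^esub> p) w"
  then obtain as where P: "P = (u \<otimes>\<^bsub>F\<^esub> p, as)" "walk K (u \<otimes>\<^bsub>F\<^esub> p) as" "pcong (forget as) w"
    by (auto simp: hcls_def)
  \<comment> \<open>The preimage is the walk from \<open>p\<close> with the same label: its
    translate has the start and the label of \<open>as\<close>, and these determine a walk.\<close>
  let ?bs = "lift_word p (forget as)"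
  have bs: "walk K p ?bs" "forget ?bs = forget as"
    using lift_word_walk forget_xwords[OF P(2)] assms by simp_all
  have "map (\<lambda>(e, b). (edge_lact X u e, b)) ?bs = as"
    using edge_lact_walk[OF assms(1) bs(1)] bs(2) lift_word_forget P(2) by metis
  moreover have "(p, ?bs) \<in> hcls p w" using bs P by (simp add: hcls_def)
  ultimately show "P \<in> mor_lact X u (hcls p w)"
    unfolding mor_lact_def P(1) by (intro image_eqI[of _ _ "(p, ?bs)"]) simp_all
qed

lemma mor_ract_hcls:
  assumes "u \<in> carrier F" "p \<in> carrier F" "w \<in> xwords"
  shows "mor_ract X (hcls p w) u = hcls (p \<otimes>\<^bsub>F\<^esub> u) (shift u w)"
proof (intro subset_antisym subsetI)
  fix P assume "P \<in> mor_ract X (hcls p w) u"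
  then show "P \<in> hcls (p \<otimes>\<^bsub>F\<^esub> u) (shift u w)"
    using edge_ract_walk[OF assms(1)] assms by (auto simp: mor_ract_def hcls_def pcong_shift)
next
  fix P assume "P \<in> hcls (p \<otimes>\<^bsub>F\<^esub> u) (shift u w)"
  then obtain as where
    P: "P = (p \<otimes>\<^bsub>F\<^esub> u, as)" "walk K (p \<otimes>\<^bsub>F\<^esub> u) as" "pcong (forget as) (shift u w)"
    by (auto simp: hcls_def)
  \<comment> \<open>Right translation changes labels, so the label is translated back before it is
    lifted from \<open>p\<close>.\<close>
  let ?v = "shift (inv\<^bsub>F\<^esub> u) (forget as)"
  let ?bs = "lift_word p ?v"
  have as: "forget as \<in> xwords" using P(2) by (rule forget_xwords)
  have bs: "walk K p ?bs" "forget ?bs = ?v"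
    using lift_word_walk[of ?v p] as assms by simp_all
  have "shift u ?v = forget as" using as assms by simp
  then have "map (\<lambda>(e, b). (edge_ract X e u, b)) ?bs = as"
    using edge_ract_walk[OF assms(1) bs(1)] bs(2) lift_word_forget P(2) by metis
  moreover have "pcong ?v w"
    using pcong_shift[OF P(3), of "inv\<^bsub>F\<^esub> u"] assms by simp
  then have "(p, ?bs) \<in> hcls p w" using bs by (simp add: hcls_def)
  ultimately show "P \<in> mor_ract X (hcls p w) u"
    unfolding mor_ract_def P(1) by (intro image_eqI[of _ _ "(p, ?bs)"]) simp_all
qed

text \<open>Elements of the star have domain \<open>1\<close>, so in a product the right translation
  of the first factor is trivial, and the left translation of the second moves its start to the
  range of the first without changing its label. In the action by \<open>g\<close> the start
  \<open>g\<inverse> 1 g\<close> is again \<open>1\<close>, and only the shift of the label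
  remains.\<close>

lemma word_xmod_star: "word_xmod X R (star_xmod X R) (hcls \<one>\<^bsub>F\<^esub>)"
proof unfold_locales
  show "carrier (star_xmod X R) = hcls \<one>\<^bsub>F\<^esub> ` xwords"
    by (simp add: star_xmod_def Let_def star_K)
  show "\<one>\<^bsub>star_xmod X R\<^esub> = hcls \<one>\<^bsub>F\<^esub> []"
    by (simp add: star_xmod_def Let_def mor_id_def hcls_lift)
  fix w assume w: "w \<in> xwords"
  show "hcls \<one>\<^bsub>F\<^esub> w \<otimes>\<^bsub>star_xmod X R\<^esub> hcls \<one>\<^bsub>F\<^esub> v = hcls \<one>\<^bsub>F\<^esub> (w @ v)" if "v \<in> xwords" for v
    using w that mor_comp_hcls[of "\<one>\<^bsub>F\<^esub>" w v]
    by (simp add: star_xmod_def Let_def mor_dom_hcls mor_ran_hcls mor_ract_hcls mor_lact_hcls)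
  show "hcls \<one>\<^bsub>F\<^esub> w = hcls \<one>\<^bsub>F\<^esub> v \<longleftrightarrow> pcong w v" if "v \<in> xwords" for v
    using w that by (intro hcls_eq_iff) auto
  show "bd (star_xmod X R) (hcls \<one>\<^bsub>F\<^esub> w) = xbd w"
    using w by (simp add: star_xmod_def Let_def mor_ran_hcls)
  show "act (star_xmod X R) (hcls \<one>\<^bsub>F\<^esub> w) g = hcls \<one>\<^bsub>F\<^esub> (shift g w)" if "g \<in> carrier F" for g
    using w that by (simp add: star_xmod_def Let_def mor_ract_hcls mor_lact_hcls)
qed

end

theorem theorem3p7:
  fixes X :: "'x set" and R :: "('x word \<times> 'x word) set"
  assumes "group_presentation X R"
  shows "free_xmod_on TYPE('t) (free_group X) (derived_xmod X R) R rho_hat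
      \<and> xmod_isomorphic (free_group X) (star_xmod X R) (derived_xmod X R)"
proof -
  interpret presentation X R by unfold_locales (rule assms)
  interpret derived: word_xmod X R "derived_xmod X R" xcos by (rule word_xmod_derived)
  show ?thesis
    using derived.free_xmod_on word_xmod_isomorphic[OF word_xmod_star word_xmod_derived] by blast
qed

end
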